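(* Let $\vec X=(X_0,X_1)$ and $\vec Y=(Y_0,Y_1)$ be couples of regular Banach lattices with the Fatou property and let $T:X_0+X_1\to Y_0+Y_1$ be a positive operator which is bounded $X_j\to Y_j$, $j=0,1$. If $T:X_0^{1-\theta_*}X_1^{\theta_*}\to Y_0^{1-\theta_*}Y_1^{\theta_*}$ is an order isomorphism for some $\theta_*\in(0,1)$, then $$T:X_0^{1-\theta}X_1^\theta\to Y_0^{1-\theta}Y_1^\theta\quad\text{and}\quad T:(X_0,X_1)_{\theta,p}\to(Y_0,Y_1)_{\theta,p}$$ are order isomorphisms for all $\theta\in(0,1)$ and all $p\in[1,\infty]$.
   Context: A Banach lattice on a $\sigma$-finite measure space $(\Omega,\Sigma,\mu)$ is a Banach space $X\subset L^0(\mu)$ containing a $\mu$-a.e. strictly positive element and solid: if $f\in L^0(\mu)$, $g\in X$, $|f|\le|g|$ a.e., then $f\in X$ and $\|f\|_X\le\|g\|_X$. Fatou property: if $0\le f_n\uparrow f$ a.e. with $f_n\in X$ and $\sup_n\|f_n\|_X<\infty$, then $f\in X$ and $\|f_n\|_X\uparrow\|f\|_X$. A Banach lattice is regular if its norm is order continuous (absolutely continuous); for couples of regular lattices $X_0\cap X_1$ is dense in each Calderón product $X_0^{1-\alpha}X_1^\alpha$, $\alpha\in(0,1)$. The Calderón product $X_0^{1-\theta}X_1^\theta$ consists of $f\in L^0(\mu)$ with $|f|\le\lambda|f_0|^{1-\theta}|f_1|^\theta$ a.e. for some $\lambda>0$ and $\|f_j\|_{X_j}\le1$, normed by the infimum of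 such $\lambda$. $(X_0,X_1)_{\theta,p}$ is the real interpolation space with norm $\big(\int_0^\infty(t^{-\theta}K(t,x;\vec X))^p\,dt/t\big)^{1/p}$ (sup for $p=\infty$), $K(t,x;\vec X)=\inf\{\|x_0\|_{X_0}+t\|x_1\|_{X_1}:x=x_0+x_1\}$; it is again a Banach lattice. $T$ is positive if $Tf\ge0$ whenever $f\ge0$. An order isomorphism is a linear bijection $T$ with $T$ and $T^{-1}$ both positive. *)

theory Defs
  imports "HOL-Analysis.Analysis"
begin

text \<open>A Banach lattice on a sigma-finite measure space M is given by a function norm
  rho on L0(M) (measurable real functions, identified a.e.); the lattice itself is the
  set of measurable f with rho f finite.\<close>

definition lat :: "'a measure \<Rightarrow> (('a \<Rightarrow> real) \<Rightarrow> ennreal) \<Rightarrow> ('a \<Rightarrow> real) set" where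
  "lat M \<rho> = {f \<in> borel_measurable M. \<rho> f < \<infinity>}"

definition banach_lattice :: "'a measure \<Rightarrow> (('a \<Rightarrow> real) \<Rightarrow> ennreal) \<Rightarrow> bool" where
  "banach_lattice M \<rho> \<longleftrightarrow>
     sigma_finite_measure M \<and>
     \<comment> \<open>norm axioms on the space\<close>
     (\<forall>f \<in> borel_measurable M. \<rho> f = 0 \<longleftrightarrow> (AE x in M. f x = 0)) \<and>
     (\<forall>f \<in> borel_measurable M. \<forall>c. \<rho> (\<lambda>x. c * f x) = ennreal \<bar>c\<bar> * \<rho> f) \<and>
     (\<forall>f \<in> borel_measurable M. \<forall>g \<in> borel_measurable M. \<rho> (\<lambda>x. f x + g x) \<le> \<rho> f + \<rho> g) \<and>
     \<comment> \<open>solidity\<close>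
     (\<forall>f \<in> borel_measurable M. \<forall>g \<in> lat M \<rho>.
        (AE x in M. \<bar>f x\<bar> \<le> \<bar>g x\<bar>) \<longrightarrow> f \<in> lat M \<rho> \<and> \<rho> f \<le> \<rho> g) \<and>
     \<comment> \<open>a.e. strictly positive element\<close>
     (\<exists>g \<in> lat M \<rho>. AE x in M. 0 < g x) \<and>
     \<comment> \<open>completeness (Banach space)\<close>
     (\<forall>s :: nat \<Rightarrow> 'a \<Rightarrow> real. (\<forall>n. s n \<in> lat M \<rho>) \<and>
        (\<forall>e>0. \<exists>N. \<forall>m\<ge>N. \<forall>n\<ge>N. \<rho> (\<lambda>x. s m x - s n x) < ennreal e) \<longrightarrow>
        (\<exists>f \<in> lat M \<rho>. (\<lambda>n. \<rho> (\<lambda>x. s n x - f x)) \<longlonglongrightarrow> 0))"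

definition fatou :: "'a measure \<Rightarrow> (('a \<Rightarrow> real) \<Rightarrow> ennreal) \<Rightarrow> bool" where
  "fatou M \<rho> \<longleftrightarrow>
     (\<forall>(fs :: nat \<Rightarrow> 'a \<Rightarrow> real) f. (\<forall>n. fs n \<in> lat M \<rho>) \<and> f \<in> borel_measurable M \<and>
        (AE x in M. 0 \<le> fs 0 x \<and> incseq (\<lambda>n. fs n x) \<and> (\<lambda>n. fs n x) \<longlonglongrightarrow> f x) \<and>
        (SUP n. \<rho> (fs n)) < \<infinity> \<longrightarrow>
        f \<in> lat M \<rho> \<and> (\<lambda>n. \<rho> (fs n)) \<longlonglongrightarrow> \<rho> f)"

text \<open>Regular = order continuous norm (sequential form: 0 <= f_n decreasing to 0 a.e.
  implies norms tend to 0).\<close>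
definition regular :: "'a measure \<Rightarrow> (('a \<Rightarrow> real) \<Rightarrow> ennreal) \<Rightarrow> bool" where
  "regular M \<rho> \<longleftrightarrow>
     (\<forall>fs :: nat \<Rightarrow> 'a \<Rightarrow> real. (\<forall>n. fs n \<in> lat M \<rho>) \<and>
        (AE x in M. (\<forall>n. 0 \<le> fs n x) \<and> decseq (\<lambda>n. fs n x) \<and> (\<lambda>n. fs n x) \<longlonglongrightarrow> 0) \<longrightarrow>
        (\<lambda>n. \<rho> (fs n)) \<longlonglongrightarrow> 0)"

definition sum_space :: "'a measure \<Rightarrow> (('a \<Rightarrow> real) \<Rightarrow> ennreal) \<Rightarrow> (('a \<Rightarrow> real) \<Rightarrow> ennreal)
    \<Rightarrow> ('a \<Rightarrow> real) set" where
  "sum_space M \<rho>0 \<rho>1 = {f \<in> borel_measurable M. \<exists>f0 \<in> lat M \<rho>0. \<exists>f1 \<in> lat M \<rho>1.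
      AE x in M. f x = f0 x + f1 x}"

definition calderon_norm :: "'a measure \<Rightarrow> (('a \<Rightarrow> real) \<Rightarrow> ennreal) \<Rightarrow> (('a \<Rightarrow> real) \<Rightarrow> ennreal)
    \<Rightarrow> real \<Rightarrow> ('a \<Rightarrow> real) \<Rightarrow> ennreal" where
  "calderon_norm M \<rho>0 \<rho>1 \<theta> f = (INF l \<in> {l::real. l > 0 \<and> (\<exists>f0 \<in> borel_measurable M. \<exists>f1 \<in> borel_measurable M.
        \<rho>0 f0 \<le> 1 \<and> \<rho>1 f1 \<le> 1 \<and>
        (AE x in M. \<bar>f x\<bar> \<le> l * (\<bar>f0 x\<bar> powr (1 - \<theta>) * \<bar>f1 x\<bar> powr \<theta>)))}. ennreal l)"

definition calderon :: "'a measure \<Rightarrow> (('a \<Rightarrow> real) \<Rightarrow> ennreal) \<Rightarrow> (('a \<Rightarrow> real) \<Rightarrow> ennreal)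
    \<Rightarrow> real \<Rightarrow> ('a \<Rightarrow> real) set" where
  "calderon M \<rho>0 \<rho>1 \<theta> = lat M (calderon_norm M \<rho>0 \<rho>1 \<theta>)"

definition Kfun :: "'a measure \<Rightarrow> (('a \<Rightarrow> real) \<Rightarrow> ennreal) \<Rightarrow> (('a \<Rightarrow> real) \<Rightarrow> ennreal)
    \<Rightarrow> real \<Rightarrow> ('a \<Rightarrow> real) \<Rightarrow> ennreal" where
  "Kfun M \<rho>0 \<rho>1 t f = (INF p \<in> {(f0, f1). f0 \<in> borel_measurable M \<and> f1 \<in> borel_measurable M \<and>
        (AE x in M. f x = f0 x + f1 x)}. \<rho>0 (fst p) + ennreal t * \<rho>1 (snd p))"

definition epow :: "ennreal \<Rightarrow> real \<Rightarrow> ennreal" where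
  "epow x q = (if x = \<infinity> then \<infinity> else ennreal (enn2real x powr q))"

definition real_interp_norm :: "'a measure \<Rightarrow> (('a \<Rightarrow> real) \<Rightarrow> ennreal) \<Rightarrow> (('a \<Rightarrow> real) \<Rightarrow> ennreal)
    \<Rightarrow> real \<Rightarrow> ennreal \<Rightarrow> ('a \<Rightarrow> real) \<Rightarrow> ennreal" where
  "real_interp_norm M \<rho>0 \<rho>1 \<theta> p f =
     (if p = \<infinity> then (SUP t \<in> {0<..}. ennreal (t powr (- \<theta>)) * Kfun M \<rho>0 \<rho>1 t f)
      else epow (\<integral>\<^sup>+ t \<in> {0<..}. epow (ennreal (t powr (- \<theta>)) * Kfun M \<rho>0 \<rho>1 t f) (enn2real p)
                    * ennreal (1 / t) \<partial>lborel) (1 / enn2real p))"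

definition real_interp :: "'a measure \<Rightarrow> (('a \<Rightarrow> real) \<Rightarrow> ennreal) \<Rightarrow> (('a \<Rightarrow> real) \<Rightarrow> ennreal)
    \<Rightarrow> real \<Rightarrow> ennreal \<Rightarrow> ('a \<Rightarrow> real) set" where
  "real_interp M \<rho>0 \<rho>1 \<theta> p = lat M (real_interp_norm M \<rho>0 \<rho>1 \<theta> p)"

definition order_iso :: "'a measure \<Rightarrow> 'b measure \<Rightarrow> (('a \<Rightarrow> real) \<Rightarrow> ('b \<Rightarrow> real))
    \<Rightarrow> ('a \<Rightarrow> real) set \<Rightarrow> ('b \<Rightarrow> real) set \<Rightarrow> bool" where
  "order_iso M N T A B \<longleftrightarrow>
     (\<forall>f \<in> A. T f \<in> B) \<and>
     (\<forall>f \<in> A. \<forall>g \<in> A. \<forall>a b. AE y in N. T (\<lambda>x. a * f x + b * g x) y = a * T f y + b * T g y) \<and>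
     (\<forall>f \<in> A. \<forall>g \<in> A. (AE y in N. T f y = T g y) \<longrightarrow> (AE x in M. f x = g x)) \<and>
     (\<forall>g \<in> B. \<exists>f \<in> A. AE y in N. T f y = g y) \<and>
     (\<forall>f \<in> A. (AE x in M. 0 \<le> f x) \<longrightarrow> (AE y in N. 0 \<le> T f y)) \<and>
     (\<forall>f \<in> A. (AE y in N. 0 \<le> T f y) \<longrightarrow> (AE x in M. 0 \<le> f x))"

definition admissible_positive_op ::
  "'a measure \<Rightarrow> (('a \<Rightarrow> real) \<Rightarrow> ennreal) \<Rightarrow> (('a \<Rightarrow> real) \<Rightarrow> ennreal) \<Rightarrow>
   'b measure \<Rightarrow> (('b \<Rightarrow> real) \<Rightarrow> ennreal) \<Rightarrow> (('b \<Rightarrow> real) \<Rightarrow> ennreal) \<Rightarrow>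
   (('a \<Rightarrow> real) \<Rightarrow> ('b \<Rightarrow> real)) \<Rightarrow> bool" where
  "admissible_positive_op M \<rho>0 \<rho>1 N \<sigma>0 \<sigma>1 T \<longleftrightarrow>
     (\<forall>f \<in> sum_space M \<rho>0 \<rho>1. T f \<in> sum_space N \<sigma>0 \<sigma>1) \<and>
     (\<forall>f \<in> sum_space M \<rho>0 \<rho>1. \<forall>g \<in> sum_space M \<rho>0 \<rho>1.
        (AE x in M. f x = g x) \<longrightarrow> (AE y in N. T f y = T g y)) \<and>
     (\<forall>f \<in> sum_space M \<rho>0 \<rho>1. \<forall>g \<in> sum_space M \<rho>0 \<rho>1. \<forall>a b.
        AE y in N. T (\<lambda>x. a * f x + b * g x) y = a * T f y + b * T g y) \<and>
     (\<forall>f \<in> sum_space M \<rho>0 \<rho>1. (AE x in M. 0 \<le> f x) \<longrightarrow> (AE y in N. 0 \<le> T f y)) \<and>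
     (\<exists>C. \<forall>f \<in> lat M \<rho>0. \<sigma>0 (T f) \<le> ennreal C * \<rho>0 f) \<and>
     (\<exists>C. \<forall>f \<in> lat M \<rho>1. \<sigma>1 (T f) \<le> ennreal C * \<rho>1 f)"

end

theory Submission
  imports Defs
begin

text \<open>The operator is already bounded below on the endpoint spaces. If \<open>f \<ge> 0\<close> and \<open>T f\<close> is in the
  unit ball of \<open>Y\<^sub>0\<close>, then for \<open>h\<close> in the unit ball of \<open>X\<^sub>1\<close> the Hoelder inequality
  \<open>T (f\<^sup>1\<^sup>-\<^sup>s h\<^sup>s) \<le> (T f)\<^sup>1\<^sup>-\<^sup>s (T h)\<^sup>s\<close> for positive operators and the invertibility of \<open>T\<close> at
  \<open>s = \<theta>s\<close> give a factorization \<open>f\<^sup>1\<^sup>-\<^sup>s h\<^sup>s \<le> C a\<^sup>1\<^sup>-\<^sup>s b\<^sup>s\<close> with \<open>a\<close>, \<open>b\<close> in the unit balls of \<open>X\<^sub>0\<close>,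
  \<open>X\<^sub>1\<close>. Iterating with \<open>b\<close> in the role of \<open>h\<close>, starting from a strictly positive \<open>h\<close>, multiplying
  the inequalities and taking \<open>n\<close>-th roots bounds \<open>f\<close> by geometric, hence by arithmetic means of
  elements of the unit ball of \<open>X\<^sub>0\<close>, up to a factor that is uniformly bounded on sets exhausting the
  space; the Fatou property then bounds the norm of \<open>f\<close> in \<open>X\<^sub>0\<close>. By order continuity \<open>T\<close> is
  injective on \<open>X\<^sub>0 + X\<^sub>1\<close> and maps \<open>X\<^sub>j\<close> onto \<open>Y\<^sub>j\<close>, so its inverse is a positive operator of the
  couples, and both operators act on all interpolation spaces.\<close>

section \<open>Weighted geometric means\<close>

definition geom_mean :: "real \<Rightarrow> real \<Rightarrow> real \<Rightarrow> real" where
  "geom_mean \<theta> a b = \<bar>a\<bar> powr (1 - \<theta>) * \<bar>b\<bar> powr \<theta>"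

lemma geom_mean_nonneg [simp]: "0 \<le> geom_mean \<theta> a b"
  by (simp add: geom_mean_def)

lemma abs_geom_mean [simp]: "\<bar>geom_mean \<theta> a b\<bar> = geom_mean \<theta> a b"
  by simp

lemma geom_mean_abs_left [simp]: "geom_mean \<theta> \<bar>a\<bar> b = geom_mean \<theta> a b"
  and geom_mean_abs_right [simp]: "geom_mean \<theta> a \<bar>b\<bar> = geom_mean \<theta> a b"
  by (simp_all add: geom_mean_def)

lemma geom_mean_self [simp]: "geom_mean \<theta> a a = \<bar>a\<bar>"
  by (simp add: geom_mean_def powr_add[symmetric])

lemma geom_mean_mult: "geom_mean \<theta> (c * a) (d * b) = geom_mean \<theta> c d * geom_mean \<theta> a b"
  by (simp add: geom_mean_def abs_mult powr_mult)

lemma geom_mean_scale: "geom_mean \<theta> (c * a) (c * b) = \<bar>c\<bar> * geom_mean \<theta> a b"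
  by (simp add: geom_mean_mult)

lemma geom_mean_mono:
  assumes "\<bar>a\<bar> \<le> \<bar>c\<bar>" "\<bar>b\<bar> \<le> \<bar>d\<bar>" "0 \<le> \<theta>" "\<theta> \<le> 1"
  shows "geom_mean \<theta> a b \<le> geom_mean \<theta> c d"
  unfolding geom_mean_def using assms by (intro mult_mono powr_mono2) auto

lemma geom_mean_le_add:
  assumes "0 \<le> \<theta>" "\<theta> \<le> 1"
  shows "geom_mean \<theta> a b \<le> \<bar>a\<bar> + \<bar>b\<bar>"
  using geom_mean_mono[of a "\<bar>a\<bar> + \<bar>b\<bar>" b "\<bar>a\<bar> + \<bar>b\<bar>" \<theta>] assms by simp

lemma borel_measurable_geom_mean [measurable (raw)]:
  assumes [measurable]: "f \<in> borel_measurable M" "g \<in> borel_measurable M"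
  shows "(\<lambda>x. geom_mean \<theta> (f x) (g x)) \<in> borel_measurable M"
  unfolding geom_mean_def by measurable

lemma geom_mean_le_weighted_sum:
  assumes "0 \<le> \<theta>" "\<theta> \<le> 1"
  shows "geom_mean \<theta> a b \<le> (1 - \<theta>) * exp (\<theta> * q) * \<bar>a\<bar> + \<theta> * exp ((\<theta> - 1) * q) * \<bar>b\<bar>"
proof (cases "a = 0 \<or> b = 0")
  case True
  then show ?thesis using assms by (auto simp: geom_mean_def)
next
  case False
  have "geom_mean \<theta> (exp (\<theta> * q)) (exp ((\<theta> - 1) * q)) = 1"
    by (simp add: geom_mean_def exp_powr_real exp_add[symmetric] algebra_simps)
  then have "geom_mean \<theta> a b = geom_mean \<theta> (exp (\<theta> * q) * a) (exp ((\<theta> - 1) * q) * b)"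
    by (simp add: geom_mean_mult)
  also have "\<dots> \<le> (1 - \<theta>) * \<bar>exp (\<theta> * q) * a\<bar> + \<theta> * \<bar>exp ((\<theta> - 1) * q) * b\<bar>"
    unfolding geom_mean_def using assms False by (intro Youngs_inequality_0) auto
  finally show ?thesis by (simp add: abs_mult mult.assoc)
qed

lemma
  assumes "0 < a" "0 < b"
  shows geom_mean_eq_exp_mult_left: "geom_mean \<theta> a b = exp (\<theta> * (ln b - ln a)) * a"
    and geom_mean_eq_exp_mult_right: "geom_mean \<theta> a b = exp ((\<theta> - 1) * (ln b - ln a)) * b"
proof -
  have "geom_mean \<theta> a b = exp (\<theta> * (ln b - ln a)) * exp (ln a)"
    "geom_mean \<theta> a b = exp ((\<theta> - 1) * (ln b - ln a)) * exp (ln b)"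
    unfolding exp_add[symmetric] using assms
    by (simp_all add: geom_mean_def powr_def exp_add[symmetric] algebra_simps)
  then show "geom_mean \<theta> a b = exp (\<theta> * (ln b - ln a)) * a"
    "geom_mean \<theta> a b = exp ((\<theta> - 1) * (ln b - ln a)) * b"
    using assms by simp_all
qed

text \<open>The infimum of the bounds in \<open>geom_mean_le_weighted_sum\<close> is attained at
  \<open>q = ln (b / a)\<close>, and rational \<open>q\<close> come arbitrarily close.\<close>
lemma le_geom_mean_of_rational_bounds:
  assumes \<theta>: "0 < \<theta>" "\<theta> < 1"
    and bound: "\<And>q. q \<in> \<rat> \<Longrightarrow>
      z \<le> (1 - \<theta>) * exp (\<theta> * q) * \<bar>a\<bar> + \<theta> * exp ((\<theta> - 1) * q) * \<bar>b\<bar>"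
  shows "z \<le> geom_mean \<theta> a b"
proof -
  have real_bound: "z \<le> (1 - \<theta>) * exp (\<theta> * q) * \<bar>a\<bar> + \<theta> * exp ((\<theta> - 1) * q) * \<bar>b\<bar>" for q
    by (rule continuous_ge_on_closure[where S = \<rat>])
      (auto simp: Rats_closure_real intro!: continuous_intros bound)
  have perturbed: "z \<le> geom_mean \<theta> (\<bar>a\<bar> + e) (\<bar>b\<bar> + e)" if "0 < e" for e
  proof -
    let ?a = "\<bar>a\<bar> + e" and ?b = "\<bar>b\<bar> + e"
    define q where "q = ln ?b - ln ?a"
    have pos: "0 < ?a" "0 < ?b" using that by auto
    have "z \<le> (1 - \<theta>) * exp (\<theta> * q) * \<bar>a\<bar> + \<theta> * exp ((\<theta> - 1) * q) * \<bar>b\<bar>"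
      by (rule real_bound)
    also have "\<dots> \<le> (1 - \<theta>) * exp (\<theta> * q) * ?a + \<theta> * exp ((\<theta> - 1) * q) * ?b"
      using that \<theta> by (intro add_mono mult_left_mono) auto
    also have "\<dots> = geom_mean \<theta> ?a ?b"
      using geom_mean_eq_exp_mult_left[OF pos, of \<theta>] geom_mean_eq_exp_mult_right[OF pos, of \<theta>]
      by (simp only: mult.assoc q_def[symmetric]) (simp add: algebra_simps)
    finally show ?thesis .
  qed
  have "((\<lambda>e. geom_mean \<theta> (\<bar>a\<bar> + e) (\<bar>b\<bar> + e)) \<longlongrightarrow> geom_mean \<theta> (\<bar>a\<bar> + 0) (\<bar>b\<bar> + 0)) (at_right 0)"
    unfolding geom_mean_def using \<theta>
    by (intro tendsto_intros tendsto_powr')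
      (auto simp: eventually_at_right_field intro!: exI[of _ 1])
  then have "z \<le> geom_mean \<theta> (\<bar>a\<bar> + 0) (\<bar>b\<bar> + 0)"
    by (rule tendsto_lowerbound)
      (use perturbed in \<open>auto simp: eventually_at_right_field intro!: exI[of _ 1]\<close>)
  then show ?thesis by simp
qed

lemma geom_mean_power_chain:
  fixes a h :: "nat \<Rightarrow> real"
  assumes C: "0 \<le> C" and chain: "\<And>i. geom_mean \<theta> f (h i) \<le> C * geom_mean \<theta> (a i) (h (Suc i))"
  shows "geom_mean \<theta> (f ^ n) (h 0) \<le> C ^ n * geom_mean \<theta> (\<Prod>i<n. a i) (h n)"
proof (induction n)
  case 0
  then show ?case by simp
next
  case (Suc n)
  let ?w = "C ^ n * \<bar>\<Prod>i<n. a i\<bar> powr (1 - \<theta>)"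
  have "geom_mean \<theta> (f ^ Suc n) (h 0) = \<bar>f\<bar> powr (1 - \<theta>) * geom_mean \<theta> (f ^ n) (h 0)"
    by (simp add: geom_mean_def abs_mult powr_mult)
  also have "\<dots> \<le> \<bar>f\<bar> powr (1 - \<theta>) * (C ^ n * geom_mean \<theta> (\<Prod>i<n. a i) (h n))"
    by (intro mult_left_mono Suc) simp
  also have "\<dots> = ?w * geom_mean \<theta> f (h n)"
    by (simp add: geom_mean_def mult_ac)
  also have "\<dots> \<le> ?w * (C * geom_mean \<theta> (a n) (h (Suc n)))"
    using C by (intro mult_left_mono chain) simp
  also have "\<dots> = C ^ Suc n * geom_mean \<theta> (\<Prod>i<Suc n. a i) (h (Suc n))"
    by (simp add: geom_mean_def abs_mult powr_mult mult_ac)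
  finally show ?case .
qed

lemma abs_le_arith_mean_of_chain:
  fixes a h :: "nat \<Rightarrow> real"
  assumes \<theta>: "0 < \<theta>" "\<theta> < 1" and C: "0 < C" and c: "0 < c" and n: "0 < n"
    and chain: "\<And>i. geom_mean \<theta> f (h i) \<le> C * geom_mean \<theta> (a i) (h (Suc i))"
    and h: "0 < h 0" "\<bar>h n\<bar> \<le> c ^ n * h 0"
  shows "\<bar>f\<bar> \<le> (C * c powr \<theta>) powr (1 / (1 - \<theta>)) * (inverse (real n) * (\<Sum>i<n. \<bar>a i\<bar>))"
proof -
  let ?P = "\<Prod>i<n. \<bar>a i\<bar>" and ?D = "C * c powr \<theta>" and ?r = "1 / (real n * (1 - \<theta>))"
  have "(\<bar>f\<bar> ^ n) powr (1 - \<theta>) * h 0 powr \<theta> = geom_mean \<theta> (f ^ n) (h 0)"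
    using h by (simp add: geom_mean_def power_abs)
  also have "\<dots> \<le> C ^ n * geom_mean \<theta> (\<Prod>i<n. a i) (h n)"
    using C by (intro geom_mean_power_chain chain) simp
  also have "\<dots> \<le> C ^ n * geom_mean \<theta> (\<Prod>i<n. a i) (c ^ n * h 0)"
    using C \<theta> h by (intro mult_left_mono geom_mean_mono) auto
  also have "\<dots> = (C ^ n * (c ^ n) powr \<theta> * ?P powr (1 - \<theta>)) * h 0 powr \<theta>"
    using c h by (simp add: geom_mean_def abs_mult powr_mult abs_prod)
  also have "(c ^ n) powr \<theta> = (c powr \<theta>) ^ n"
    using c by (simp add: powr_realpow[symmetric] powr_powr mult.commute)
  finally have "(\<bar>f\<bar> ^ n) powr (1 - \<theta>) \<le> ?D ^ n * ?P powr (1 - \<theta>)"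
    using h by (simp add: power_mult_distrib)
  then have "((\<bar>f\<bar> ^ n) powr (1 - \<theta>)) powr ?r \<le> (?D ^ n * ?P powr (1 - \<theta>)) powr ?r"
    using \<theta> n by (intro powr_mono2) auto
  moreover have "((\<bar>f\<bar> ^ n) powr (1 - \<theta>)) powr ?r = \<bar>f\<bar>"
  proof (cases "f = 0")
    case False
    then show ?thesis using \<theta> n by (simp add: powr_powr powr_realpow[symmetric])
  qed (use n in simp)
  moreover have "(?D ^ n * ?P powr (1 - \<theta>)) powr ?r = ?D powr (1 / (1 - \<theta>)) * ?P powr (1 / real n)"
    using C c \<theta> n by (simp add: powr_mult powr_powr powr_realpow[symmetric])
  ultimately have "\<bar>f\<bar> \<le> ?D powr (1 / (1 - \<theta>)) * ?P powr (1 / real n)" by simp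
  also have "\<dots> \<le> ?D powr (1 / (1 - \<theta>)) * (\<Sum>i<n. \<bar>a i\<bar> / real n)"
    using arith_geom_mean[of "{..<n}" "\<lambda>i. \<bar>a i\<bar>"] n by (intro mult_left_mono) auto
  also have "(\<Sum>i<n. \<bar>a i\<bar> / real n) = inverse (real n) * (\<Sum>i<n. \<bar>a i\<bar>)"
    by (simp add: sum_divide_distrib[symmetric] field_simps)
  finally show ?thesis .
qed

lemma ennreal_inverse_mult_le_iff:
  assumes "0 < c"
  shows "ennreal (inverse c) * x \<le> y \<longleftrightarrow> x \<le> ennreal c * y"
proof -
  have cancel: "ennreal c * (ennreal (inverse c) * z) = z"
    "ennreal (inverse c) * (ennreal c * z) = z" for z
    using assms by (simp_all add: mult.assoc[symmetric] ennreal_mult[symmetric])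
  show ?thesis
    using mult_left_mono[of "ennreal (inverse c) * x" y "ennreal c"]
      mult_left_mono[of x "ennreal c * y" "ennreal (inverse c)"] by (auto simp: cancel)
qed

lemma le_ennreal_mult_of_real_bounds:
  assumes K: "0 < K" and bound: "\<And>m. 0 < m \<Longrightarrow> x \<le> ennreal m \<Longrightarrow> y \<le> ennreal (K * m)"
  shows "y \<le> ennreal K * x"
proof (cases x)
  case (real r)
  have "y \<le> ennreal (K * r)"
  proof (rule ennreal_le_epsilon)
    fix e :: real assume e: "0 < e"
    have "y \<le> ennreal (K * (r + e / K))"
      by (rule bound) (use real e K in \<open>auto intro: add_nonneg_pos ennreal_leI\<close>)
    also have "\<dots> = ennreal (K * r) + ennreal e"
      using K e real by (simp add: distrib_left)
    finally show "y \<le> ennreal (K * r) + ennreal e" .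
  qed
  then show ?thesis using real K by (simp add: ennreal_mult)
qed (use K in \<open>simp add: ennreal_mult_top\<close>)

section \<open>Banach function lattices\<close>

definition unit_ball :: "'a measure \<Rightarrow> (('a \<Rightarrow> real) \<Rightarrow> ennreal) \<Rightarrow> ('a \<Rightarrow> real) set" where
  "unit_ball M \<rho> = {f \<in> borel_measurable M. \<rho> f \<le> 1}"

definition decreases_to_0 :: "'a measure \<Rightarrow> (nat \<Rightarrow> 'a \<Rightarrow> real) \<Rightarrow> bool" where
  "decreases_to_0 M e \<longleftrightarrow>
     (AE x in M. (\<forall>n. 0 \<le> e n x) \<and> decseq (\<lambda>n. e n x) \<and> (\<lambda>n. e n x) \<longlonglongrightarrow> 0)"

lemma decreases_to_0_nonneg: "decreases_to_0 M e \<Longrightarrow> AE x in M. \<forall>n. 0 \<le> e n x"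
  and decreases_to_0_decseq: "decreases_to_0 M e \<Longrightarrow> AE x in M. decseq (\<lambda>n. e n x)"
  unfolding decreases_to_0_def by (auto elim!: eventually_mono)

lemma decreases_to_0_min:
  assumes "decreases_to_0 M e" "\<And>x. 0 \<le> a x"
  shows "decreases_to_0 M (\<lambda>n x. min (e n x) (a x))"
  unfolding decreases_to_0_def
  using assms(1)[unfolded decreases_to_0_def]
proof eventually_elim
  case (elim x)
  then have "(\<lambda>n. min (e n x) (a x)) \<longlonglongrightarrow> min 0 (a x)" by (intro tendsto_min tendsto_const) simp
  moreover have "decseq (\<lambda>n. min (e n x) (a x))"
    using elim by (intro decseq_SucI min.mono) (auto dest: decseq_SucD)
  ultimately show ?case using elim assms(2)[of x] by simp
qed

lemma decreases_to_0_excess: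
  assumes "decreases_to_0 M e" "\<And>x. 0 \<le> a x"
  shows "decreases_to_0 M (\<lambda>n x. max 0 (e n x - a x))"
  unfolding decreases_to_0_def
  using assms(1)[unfolded decreases_to_0_def]
proof eventually_elim
  case (elim x)
  then have "(\<lambda>n. max 0 (e n x - a x)) \<longlonglongrightarrow> max 0 (0 - a x)"
    by (intro tendsto_max tendsto_diff tendsto_const) simp
  moreover have "decseq (\<lambda>n. max 0 (e n x - a x))"
    using elim by (intro decseq_SucI max.mono diff_right_mono) (auto dest: decseq_SucD)
  ultimately show ?case using elim assms(2)[of x] by simp
qed

definition truncation :: "('a \<Rightarrow> real) \<Rightarrow> nat \<Rightarrow> ('a \<Rightarrow> real) \<Rightarrow> 'a \<Rightarrow> real" where
  "truncation u k f = (\<lambda>x. min (f x) (real k * u x))"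

lemma truncation_le: "truncation u k f x \<le> f x"
  by (simp add: truncation_def)

lemma truncation_mono: "0 \<le> u x \<Longrightarrow> k \<le> l \<Longrightarrow> truncation u k f x \<le> truncation u l f x"
  unfolding truncation_def by (intro min.mono mult_right_mono) auto

lemma truncation_nonneg: "0 \<le> u x \<Longrightarrow> 0 \<le> f x \<Longrightarrow> 0 \<le> truncation u k f x"
  by (simp add: truncation_def)

lemma borel_measurable_truncation [measurable (raw)]:
  assumes [measurable]: "f \<in> borel_measurable M" "u \<in> borel_measurable M"
  shows "truncation u k f \<in> borel_measurable M"
  unfolding truncation_def by measurable

lemma truncation_remainder_decreases_to_0:
  assumes "AE x in M. 0 < u x"
  shows "decreases_to_0 M (\<lambda>k x. f x - truncation u k f x)"
  unfolding decreases_to_0_def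
  using assms
proof eventually_elim
  case (elim x)
  obtain k where "f x / u x < real k" using reals_Archimedean2 by blast
  then have k: "f x \<le> real k * u x" using elim by (simp add: field_simps)
  have "truncation u n f x = f x" if "k \<le> n" for n
    using truncation_mono[of u x k n f] truncation_le[of u n f x] elim that k
    by (simp add: truncation_def)
  then have "(\<lambda>n. f x - truncation u n f x) \<longlonglongrightarrow> 0"
    by (intro tendsto_eventually eventually_sequentiallyI[of k]) simp
  moreover have "decseq (\<lambda>n. f x - truncation u n f x)"
    using elim by (intro decseq_SucI diff_left_mono truncation_mono) auto
  ultimately show ?case by (simp add: truncation_le)
qed

locale function_lattice =
  fixes M :: "'a measure" and \<rho> :: "('a \<Rightarrow> real) \<Rightarrow> ennreal"
  assumes banach: "banach_lattice M \<rho>"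
begin

lemma norm_eq_0_iff: "f \<in> borel_measurable M \<Longrightarrow> \<rho> f = 0 \<longleftrightarrow> (AE x in M. f x = 0)"
  and norm_scale: "f \<in> borel_measurable M \<Longrightarrow> \<rho> (\<lambda>x. c * f x) = ennreal \<bar>c\<bar> * \<rho> f"
  and norm_add: "f \<in> borel_measurable M \<Longrightarrow> g \<in> borel_measurable M \<Longrightarrow>
    \<rho> (\<lambda>x. f x + g x) \<le> \<rho> f + \<rho> g"
  and lat_solid: "f \<in> borel_measurable M \<Longrightarrow> g \<in> lat M \<rho> \<Longrightarrow> AE x in M. \<bar>f x\<bar> \<le> \<bar>g x\<bar> \<Longrightarrow>
    f \<in> lat M \<rho>"
  and ex_positive: "\<exists>g \<in> lat M \<rho>. AE x in M. 0 < g x"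
  and complete: "\<forall>n. s n \<in> lat M \<rho> \<Longrightarrow>
    \<forall>e>0. \<exists>N. \<forall>m\<ge>N. \<forall>n\<ge>N. \<rho> (\<lambda>x. s m x - s n x) < ennreal e \<Longrightarrow>
    \<exists>f \<in> lat M \<rho>. (\<lambda>n. \<rho> (\<lambda>x. s n x - f x)) \<longlonglongrightarrow> 0"
  using banach unfolding banach_lattice_def by (blast+)

lemma norm_mono:
  assumes "f \<in> borel_measurable M" "g \<in> borel_measurable M" "AE x in M. \<bar>f x\<bar> \<le> \<bar>g x\<bar>"
  shows "\<rho> f \<le> \<rho> g"
proof (cases "\<rho> g < \<infinity>")
  case True
  then show ?thesis using banach assms unfolding banach_lattice_def lat_def by blast
qed (simp add: not_less top_unique)

lemma norm_abs: "f \<in> borel_measurable M \<Longrightarrow> \<rho> (\<lambda>x. \<bar>f x\<bar>) = \<rho> f"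
  by (intro antisym norm_mono) auto

lemma norm_minus_commute:
  "f \<in> borel_measurable M \<Longrightarrow> g \<in> borel_measurable M \<Longrightarrow> \<rho> (\<lambda>x. f x - g x) = \<rho> (\<lambda>x. g x - f x)"
  by (intro antisym norm_mono) auto

lemma norm_cong:
  "f \<in> borel_measurable M \<Longrightarrow> g \<in> borel_measurable M \<Longrightarrow> AE x in M. f x = g x \<Longrightarrow> \<rho> f = \<rho> g"
  by (intro antisym norm_mono) auto

lemma norm_sum_le:
  assumes "\<And>i. i < (n::nat) \<Longrightarrow> f i \<in> borel_measurable M"
  shows "\<rho> (\<lambda>x. \<Sum>i<n. f i x) \<le> (\<Sum>i<n. \<rho> (f i))"
  using assms
proof (induction n)
  case 0
  then show ?case using norm_eq_0_iff[of "\<lambda>x. 0"] by simp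
next
  case (Suc n)
  have "\<rho> (\<lambda>x. (\<Sum>i<n. f i x) + f n x) \<le> \<rho> (\<lambda>x. \<Sum>i<n. f i x) + \<rho> (f n)"
    using Suc.prems by (intro norm_add borel_measurable_sum) auto
  also have "\<dots> \<le> (\<Sum>i<n. \<rho> (f i)) + \<rho> (f n)"
    using Suc by (intro add_right_mono) auto
  finally show ?case by simp
qed

lemma AE_eq_0_of_norm_le:
  assumes "f \<in> borel_measurable M" "\<And>n. \<rho> f \<le> a n" "a \<longlonglongrightarrow> 0"
  shows "AE x in M. f x = 0"
proof -
  have "\<rho> f \<le> 0" by (rule LIMSEQ_le_const[OF assms(3)]) (use assms(2) in auto)
  then show ?thesis using norm_eq_0_iff[OF assms(1)] by simp
qed

lemma lat_measurable [measurable_dest]: "f \<in> lat M \<rho> \<Longrightarrow> f \<in> borel_measurable M"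
  and lat_finite: "f \<in> lat M \<rho> \<Longrightarrow> \<rho> f < \<infinity>"
  by (simp_all add: lat_def)

lemma latI: "f \<in> borel_measurable M \<Longrightarrow> \<rho> f \<le> ennreal c \<Longrightarrow> f \<in> lat M \<rho>"
  by (auto simp: lat_def intro: le_less_trans)

lemma lat_norm_bound:
  assumes "f \<in> lat M \<rho>"
  obtains c where "0 < c" "\<rho> f \<le> ennreal c"
proof (rule that[of "max 1 (enn2real (\<rho> f))"])
  have "\<rho> f = ennreal (enn2real (\<rho> f))" using lat_finite[OF assms] by simp
  also have "\<dots> \<le> ennreal (max 1 (enn2real (\<rho> f)))" by (intro ennreal_leI) simp
  finally show "\<rho> f \<le> ennreal (max 1 (enn2real (\<rho> f)))" .
qed simp

lemma zero_lat: "(\<lambda>x. 0) \<in> lat M \<rho>"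
  using norm_eq_0_iff[of "\<lambda>x. 0"] by (simp add: lat_def)

lemma lat_scale: "f \<in> lat M \<rho> \<Longrightarrow> (\<lambda>x. c * f x) \<in> lat M \<rho>"
  by (auto simp: lat_def norm_scale ennreal_mult_less_top)

lemma lat_add: "f \<in> lat M \<rho> \<Longrightarrow> g \<in> lat M \<rho> \<Longrightarrow> (\<lambda>x. f x + g x) \<in> lat M \<rho>"
  using norm_add[of f g] by (auto simp: lat_def intro: le_less_trans)

lemma lat_diff: "f \<in> lat M \<rho> \<Longrightarrow> g \<in> lat M \<rho> \<Longrightarrow> (\<lambda>x. f x - g x) \<in> lat M \<rho>"
  using lat_add[OF _ lat_scale[of g "-1"]] by simp

lemma lat_abs: "f \<in> lat M \<rho> \<Longrightarrow> (\<lambda>x. \<bar>f x\<bar>) \<in> lat M \<rho>"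
  by (rule lat_solid[of _ f]) (auto simp: lat_def)

lemma lat_AE_cong:
  "f \<in> lat M \<rho> \<Longrightarrow> g \<in> borel_measurable M \<Longrightarrow> AE x in M. g x = f x \<Longrightarrow> g \<in> lat M \<rho>"
  by (rule lat_solid[of _ f]) auto

lemma lat_truncation:
  assumes f: "f \<in> borel_measurable M" "AE x in M. 0 \<le> f x" and u: "u \<in> lat M \<rho>" "\<And>x. 0 \<le> u x"
  shows "truncation u k f \<in> lat M \<rho>"
proof (rule lat_solid[OF _ lat_scale[OF u(1), of "real k"]])
  show "AE x in M. \<bar>truncation u k f x\<bar> \<le> \<bar>real k * u x\<bar>"
    using f(2) by eventually_elim (use u(2) in \<open>auto simp: truncation_def min_def abs_mult\<close>)
qed (use f(1) u(1) in measurable)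

lemma unit_ball_measurable [measurable_dest]: "f \<in> unit_ball M \<rho> \<Longrightarrow> f \<in> borel_measurable M"
  and unit_ball_norm: "f \<in> unit_ball M \<rho> \<Longrightarrow> \<rho> f \<le> 1"
  by (simp_all add: unit_ball_def)

lemma unit_ball_lat: "f \<in> unit_ball M \<rho> \<Longrightarrow> f \<in> lat M \<rho>"
  by (auto simp: unit_ball_def intro: latI[of _ 1])

lemma scaled_in_unit_ball_iff:
  assumes "f \<in> borel_measurable M" "0 < m"
  shows "(\<lambda>x. inverse m * f x) \<in> unit_ball M \<rho> \<longleftrightarrow> \<rho> f \<le> ennreal m"
  using assms by (simp add: unit_ball_def norm_scale ennreal_inverse_mult_le_iff)

lemma ex_positive_unit_ball:
  obtains h where "h \<in> unit_ball M \<rho>" "AE x in M. 0 < h x"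
proof -
  obtain g where g: "g \<in> lat M \<rho>" "AE x in M. 0 < g x" using ex_positive by blast
  obtain c where c: "0 < c" "\<rho> g \<le> ennreal c" by (rule lat_norm_bound[OF g(1)])
  show ?thesis
  proof (rule that)
    show "(\<lambda>x. inverse c * g x) \<in> unit_ball M \<rho>"
      using c by (simp add: scaled_in_unit_ball_iff lat_measurable[OF g(1)])
    show "AE x in M. 0 < inverse c * g x" using g(2) by eventually_elim (simp add: c(1))
  qed
qed

lemma arith_mean_unit_ball:
  assumes a: "\<And>i. a i \<in> unit_ball M \<rho>" and n: "0 < n"
  shows "(\<lambda>x. inverse (real n) * (\<Sum>i<n. \<bar>a i x\<bar>)) \<in> unit_ball M \<rho>"
proof -
  note [measurable] = unit_ball_measurable[OF a]
  have "\<rho> (\<lambda>x. \<Sum>i<n. \<bar>a i x\<bar>) \<le> (\<Sum>i<n. \<rho> (\<lambda>x. \<bar>a i x\<bar>))"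
    by (rule norm_sum_le) measurable
  also have "\<dots> \<le> (\<Sum>i<n. 1)"
    by (intro sum_mono) (simp add: norm_abs unit_ball_norm[OF a])
  also have "\<dots> = ennreal (real n)" by (simp add: ennreal_of_nat_eq_real_of_nat)
  finally show ?thesis using n by (simp add: scaled_in_unit_ball_iff)
qed

lemma norm_tendsto_0_of_decreasing:
  assumes "regular M \<rho>" "\<And>n. e n \<in> lat M \<rho>" "decreases_to_0 M e"
  shows "(\<lambda>n. \<rho> (e n)) \<longlonglongrightarrow> 0"
  using assms unfolding regular_def decreases_to_0_def by blast

lemma AE_tendsto_0_of_decreasing:
  assumes d [measurable]: "\<And>n. d n \<in> borel_measurable M"
    and nonneg: "AE x in M. \<forall>n. 0 \<le> d n x" and dec: "AE x in M. decseq (\<lambda>n. d n x)"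
    and norm_le: "\<And>n. \<rho> (d n) \<le> a n" and a: "a \<longlonglongrightarrow> 0"
  shows "AE x in M. (\<lambda>n. d n x) \<longlonglongrightarrow> 0"
proof -
  have bdd: "bdd_below (range (\<lambda>n. \<bar>d n x\<bar>))" for x by (rule bdd_belowI[of _ 0]) auto
  define l where "l x = (INF n. \<bar>d n x\<bar>)" for x
  have l [measurable]: "l \<in> borel_measurable M" unfolding l_def by measurable
  have "AE x in M. l x = 0"
  proof (rule AE_eq_0_of_norm_le[OF l _ a])
    fix n
    have "0 \<le> l x" "l x \<le> \<bar>d n x\<bar>" for x
      unfolding l_def using bdd[of x] by (auto intro: cINF_greatest cINF_lower)
    then have "\<rho> l \<le> \<rho> (d n)" by (intro norm_mono) auto
    then show "\<rho> l \<le> a n" using norm_le by (rule order_trans)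
  qed
  then show ?thesis
    using nonneg dec
  proof eventually_elim
    case (elim x)
    then have "(\<lambda>n. \<bar>d n x\<bar>) \<longlonglongrightarrow> l x"
      unfolding l_def by (intro LIMSEQ_decseq_INF bdd) simp
    then show ?case using elim by simp
  qed
qed

lemma norm_le_of_exhaustion:
  assumes fatou: "fatou M \<rho>" and f [measurable]: "f \<in> borel_measurable M"
    and \<Omega> [measurable]: "\<And>n. \<Omega> n \<in> sets M"
    and exhaust: "incseq \<Omega>" "AE x in M. x \<in> (\<Union>n. \<Omega> n)"
    and bound: "\<And>n. \<rho> (\<lambda>x. indicator (\<Omega> n) x * \<bar>f x\<bar>) \<le> ennreal K"
  shows "\<rho> f \<le> ennreal K"
proof -
  let ?F = "\<lambda>n x. indicator (\<Omega> n) x * \<bar>f x\<bar>"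
  have "AE x in M. 0 \<le> ?F 0 x \<and> incseq (\<lambda>n. ?F n x) \<and> (\<lambda>n. ?F n x) \<longlonglongrightarrow> \<bar>f x\<bar>"
    using exhaust(2)
  proof eventually_elim
    case (elim x)
    then obtain k where "x \<in> \<Omega> k" by blast
    then have "x \<in> \<Omega> n" if "k \<le> n" for n using incseqD[OF exhaust(1) that] by blast
    then have "(\<lambda>n. ?F n x) \<longlonglongrightarrow> \<bar>f x\<bar>"
      by (intro tendsto_eventually eventually_sequentiallyI[of k]) simp
    moreover have "incseq (\<lambda>n. ?F n x)"
      using incseqD[OF exhaust(1)] by (intro monoI mult_right_mono) (auto simp: indicator_def)
    ultimately show ?case by simp
  qed
  moreover have "?F n \<in> lat M \<rho>" for n using bound by (intro latI) auto
  moreover have "(SUP n. \<rho> (?F n)) < \<infinity>"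
    using SUP_least[of UNIV "\<lambda>n. \<rho> (?F n)", OF bound] by (rule le_less_trans) simp
  ultimately have "(\<lambda>n. \<rho> (?F n)) \<longlonglongrightarrow> \<rho> (\<lambda>x. \<bar>f x\<bar>)"
    using fatou unfolding fatou_def by (auto dest!: spec[of _ ?F])
  then have "\<rho> (\<lambda>x. \<bar>f x\<bar>) \<le> ennreal K"
    by (rule LIMSEQ_le_const2) (use bound in auto)
  then show ?thesis by (simp add: norm_abs)
qed

definition converges :: "(nat \<Rightarrow> 'a \<Rightarrow> real) \<Rightarrow> ('a \<Rightarrow> real) \<Rightarrow> bool" where
  "converges s f \<longleftrightarrow> (\<lambda>n. \<rho> (\<lambda>x. s n x - f x)) \<longlonglongrightarrow> 0"

lemma converges_unique:
  assumes "converges s f" "converges s g"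
    and [measurable]: "\<And>n. s n \<in> borel_measurable M"
      "f \<in> borel_measurable M" "g \<in> borel_measurable M"
  shows "AE x in M. f x = g x"
proof -
  have "AE x in M. f x - g x = 0"
  proof (rule AE_eq_0_of_norm_le)
    fix n
    have "\<rho> (\<lambda>x. f x - g x) = \<rho> (\<lambda>x. (f x - s n x) + (s n x - g x))" by simp
    also have "\<dots> \<le> \<rho> (\<lambda>x. f x - s n x) + \<rho> (\<lambda>x. s n x - g x)" by (rule norm_add) measurable
    also have "\<rho> (\<lambda>x. f x - s n x) = \<rho> (\<lambda>x. s n x - f x)" by (rule norm_minus_commute) measurable
    finally show "\<rho> (\<lambda>x. f x - g x) \<le> \<rho> (\<lambda>x. s n x - f x) + \<rho> (\<lambda>x. s n x - g x)" .
    show "(\<lambda>n. \<rho> (\<lambda>x. s n x - f x) + \<rho> (\<lambda>x. s n x - g x)) \<longlonglongrightarrow> 0"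
      using tendsto_add[OF assms(1,2)[unfolded converges_def]] by simp
  qed measurable
  then show ?thesis by simp
qed

lemma converges_of_increments:
  assumes s: "\<And>n. s n \<in> lat M \<rho>"
    and incr: "\<And>k n. \<rho> (\<lambda>x. s (k + n) x - s k x) \<le> e k" and e: "e \<longlonglongrightarrow> 0"
  obtains f where "f \<in> lat M \<rho>" "converges s f"
proof -
  have diff_le: "\<rho> (\<lambda>x. s m x - s n x) \<le> max (e m) (e n)" for m n
  proof (cases "n \<le> m")
    case True
    then show ?thesis using incr[of n "m - n"] by (simp add: le_max_iff_disj)
  next
    case False
    then show ?thesis
      using incr[of m "n - m"]
        norm_minus_commute[OF lat_measurable[OF s] lat_measurable[OF s], of m n]
      by (simp add: le_max_iff_disj)
  qed
  have "\<forall>\<delta>>0. \<exists>N. \<forall>m\<ge>N. \<forall>n\<ge>N. \<rho> (\<lambda>x. s m x - s n x) < ennreal \<delta>"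
  proof (intro allI impI)
    fix \<delta> :: real assume "0 < \<delta>"
    then obtain N where "\<And>n. N \<le> n \<Longrightarrow> e n < ennreal \<delta>"
      using order_tendstoD(2)[OF e, of "ennreal \<delta>"] by (auto simp: eventually_sequentially)
    then have "\<rho> (\<lambda>x. s m x - s n x) < ennreal \<delta>" if "N \<le> m" "N \<le> n" for m n
      using that by (intro le_less_trans[OF diff_le]) simp
    then show "\<exists>N. \<forall>m\<ge>N. \<forall>n\<ge>N. \<rho> (\<lambda>x. s m x - s n x) < ennreal \<delta>" by blast
  qed
  then show ?thesis using complete[of s] s that unfolding converges_def by blast
qed

lemma incseq_le_limit:
  assumes s [measurable]: "\<And>n. s n \<in> borel_measurable M"
    and f [measurable]: "f \<in> borel_measurable M"
    and mono: "\<And>x. incseq (\<lambda>n. s n x)" and lim: "converges s f"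
  shows "AE x in M. s n x \<le> f x"
proof -
  have "AE x in M. max 0 (s n x - f x) = 0"
  proof (rule AE_eq_0_of_norm_le)
    show "\<rho> (\<lambda>x. max 0 (s n x - f x)) \<le> \<rho> (\<lambda>x. s (m + n) x - f x)" for m
    proof (rule norm_mono)
      show "AE x in M. \<bar>max 0 (s n x - f x)\<bar> \<le> \<bar>s (m + n) x - f x\<bar>"
      proof (rule AE_I2)
        fix x
        have "s n x \<le> s (m + n) x" using mono by (rule incseqD) simp
        then show "\<bar>max 0 (s n x - f x)\<bar> \<le> \<bar>s (m + n) x - f x\<bar>" by auto
      qed
    qed measurable
    show "(\<lambda>m. \<rho> (\<lambda>x. s (m + n) x - f x)) \<longlonglongrightarrow> 0"
      using lim unfolding converges_def by (rule LIMSEQ_ignore_initial_segment)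
  qed measurable
  then show ?thesis by eventually_elim (simp add: max_def split: if_splits)
qed

lemma ex_upper_bound_of_summable:
  assumes f [measurable]: "\<And>i. f i \<in> borel_measurable M" and nonneg: "\<And>i x. 0 \<le> f i x"
    and norm_le: "\<And>i. \<rho> (f i) \<le> ennreal (c i)" and c: "\<And>i. 0 \<le> c i" "summable c"
  obtains A where "A \<in> lat M \<rho>" "\<And>i. AE x in M. f i x \<le> A x"
proof -
  define s where "s n x = (\<Sum>i<n. f i x)" for n x
  have [measurable]: "s n \<in> borel_measurable M" for n unfolding s_def by measurable
  have tail: "\<rho> (\<lambda>x. s (k + n) x - s k x) \<le> ennreal (\<Sum>i. c (i + k))" for k n
  proof -
    have "s (k + n) x = s k x + (\<Sum>i<n. f (i + k) x)" for x
      by (induction n) (simp_all add: s_def ac_simps)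
    then have "\<rho> (\<lambda>x. s (k + n) x - s k x) \<le> (\<Sum>i<n. \<rho> (f (i + k)))"
      using norm_sum_le[of n "\<lambda>i. f (i + k)"] by simp
    also have "\<dots> \<le> (\<Sum>i<n. ennreal (c (i + k)))" by (intro sum_mono norm_le)
    also have "\<dots> = ennreal (\<Sum>i<n. c (i + k))" using c(1) by (simp add: sum_ennreal)
    also have "\<dots> \<le> ennreal (\<Sum>i. c (i + k))"
      using c by (intro ennreal_leI sum_le_suminf) (simp_all add: summable_iff_shift)
    finally show ?thesis .
  qed
  have s_lat: "s n \<in> lat M \<rho>" for n
    using tail[of 0 n] by (intro latI) (simp_all add: s_def[of 0])
  have "(\<lambda>k. ennreal (\<Sum>i. c (i + k))) \<longlonglongrightarrow> ennreal 0"
    by (intro tendsto_ennrealI suminf_exist_split2 c(2))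
  then obtain A where A: "A \<in> lat M \<rho>" "converges s A"
    using converges_of_increments[OF s_lat tail] by auto
  show ?thesis
  proof (rule that[OF A(1)])
    fix i
    have "AE x in M. s (Suc i) x \<le> A x"
    proof (rule incseq_le_limit[OF _ lat_measurable[OF A(1)] _ A(2)])
      show "incseq (\<lambda>n. s n x)" for x
        unfolding s_def using nonneg by (intro incseq_SucI) simp
    qed measurable
    then show "AE x in M. f i x \<le> A x"
    proof eventually_elim
      case (elim x)
      have "f i x \<le> s (Suc i) x" unfolding s_def using nonneg by (simp add: sum_nonneg)
      then show ?case using elim by simp
    qed
  qed
qed

lemma unit_ball_common_bound:
  assumes a: "\<And>n. a n \<in> unit_ball M \<rho>"
  obtains A where "A \<in> lat M \<rho>" "\<And>n. AE x in M. \<bar>a n x\<bar> \<le> 2 ^ n * \<bar>A x\<bar>"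
proof -
  note [measurable] = unit_ball_measurable[OF a]
  obtain A where A: "A \<in> lat M \<rho>" "\<And>n. AE x in M. (1 / 2) ^ n * \<bar>a n x\<bar> \<le> A x"
  proof (rule ex_upper_bound_of_summable[of "\<lambda>n x. (1 / 2) ^ n * \<bar>a n x\<bar>" "\<lambda>n. (1 / 2) ^ n"])
    show "\<rho> (\<lambda>x. (1 / 2) ^ n * \<bar>a n x\<bar>) \<le> ennreal ((1 / 2) ^ n)" for n
      using mult_left_mono[OF unit_ball_norm[OF a], of "ennreal ((1 / 2) ^ n)" n]
      by (simp add: norm_scale norm_abs)
  qed (auto simp: summable_geometric)
  show ?thesis
  proof (rule that[OF A(1)])
    show "AE x in M. \<bar>a n x\<bar> \<le> 2 ^ n * \<bar>A x\<bar>" for n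
      using A(2)[of n]
    proof eventually_elim
      case (elim x)
      then have "(1 / 2) ^ n * \<bar>a n x\<bar> \<le> \<bar>A x\<bar>" by linarith
      then show ?case by (simp add: field_simps)
    qed
  qed
qed

end

section \<open>Couples of lattices and Calderon products\<close>

lemma sum_spaceI:
  assumes "f \<in> borel_measurable M" "f0 \<in> lat M \<rho>0" "f1 \<in> lat M \<rho>1" "AE x in M. f x = f0 x + f1 x"
  shows "f \<in> sum_space M \<rho>0 \<rho>1"
  using assms unfolding sum_space_def by blast

lemma sum_spaceE:
  assumes "f \<in> sum_space M \<rho>0 \<rho>1"
  obtains f0 f1 where "f \<in> borel_measurable M" "f0 \<in> lat M \<rho>0" "f1 \<in> lat M \<rho>1"
    "AE x in M. f x = f0 x + f1 x"
  using assms unfolding sum_space_def by blast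

lemma sum_space_commute: "sum_space M \<rho>1 \<rho>0 = sum_space M \<rho>0 \<rho>1"
proof -
  have "sum_space M a b \<subseteq> sum_space M b a" for a b
  proof
    fix f assume "f \<in> sum_space M a b"
    then obtain f0 f1 where f: "f \<in> borel_measurable M" "f0 \<in> lat M a" "f1 \<in> lat M b"
      "AE x in M. f x = f0 x + f1 x" by (rule sum_spaceE)
    show "f \<in> sum_space M b a"
      by (rule sum_spaceI[OF f(1,3,2)]) (use f(4) in \<open>simp add: add.commute\<close>)
  qed
  then show ?thesis by blast
qed

lemma calderon_norm_eq_geom_mean:
  "calderon_norm M \<rho>0 \<rho>1 \<theta> f = (INF l \<in> {l. 0 < l \<and> (\<exists>f0\<in>unit_ball M \<rho>0. \<exists>f1\<in>unit_ball M \<rho>1.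
     AE x in M. \<bar>f x\<bar> \<le> l * geom_mean \<theta> (f0 x) (f1 x))}. ennreal l)"
proof -
  have "{l. 0 < l \<and> (\<exists>f0\<in>unit_ball M \<rho>0. \<exists>f1\<in>unit_ball M \<rho>1.
      AE x in M. \<bar>f x\<bar> \<le> l * geom_mean \<theta> (f0 x) (f1 x))} =
    {l. l > 0 \<and> (\<exists>f0 \<in> borel_measurable M. \<exists>f1 \<in> borel_measurable M. \<rho>0 f0 \<le> 1 \<and> \<rho>1 f1 \<le> 1 \<and>
      (AE x in M. \<bar>f x\<bar> \<le> l * (\<bar>f0 x\<bar> powr (1 - \<theta>) * \<bar>f1 x\<bar> powr \<theta>)))}"
    by (auto simp: unit_ball_def geom_mean_def)
  then show ?thesis unfolding calderon_norm_def by simp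
qed

lemma calderon_commute: "calderon M \<rho>1 \<rho>0 (1 - \<theta>) = calderon M \<rho>0 \<rho>1 \<theta>"
proof -
  have swap: "geom_mean (1 - \<theta>) a b = geom_mean \<theta> b a" for a b
    by (simp add: geom_mean_def)
  have "(\<exists>f0\<in>unit_ball M \<rho>1. \<exists>f1\<in>unit_ball M \<rho>0.
        AE x in M. \<bar>f x\<bar> \<le> l * geom_mean (1 - \<theta>) (f0 x) (f1 x)) \<longleftrightarrow>
      (\<exists>f0\<in>unit_ball M \<rho>0. \<exists>f1\<in>unit_ball M \<rho>1.
        AE x in M. \<bar>f x\<bar> \<le> l * geom_mean \<theta> (f0 x) (f1 x))" for f l
    unfolding swap by blast
  then have "calderon_norm M \<rho>1 \<rho>0 (1 - \<theta>) = calderon_norm M \<rho>0 \<rho>1 \<theta>"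
    by (simp add: fun_eq_iff calderon_norm_eq_geom_mean)
  then show ?thesis by (simp add: calderon_def)
qed

locale lattice_couple =
  L0: function_lattice M \<rho>0 + L1: function_lattice M \<rho>1
  for M :: "'a measure" and \<rho>0 \<rho>1 :: "('a \<Rightarrow> real) \<Rightarrow> ennreal"
begin

abbreviation ambient :: "('a \<Rightarrow> real) set" where
  "ambient \<equiv> sum_space M \<rho>0 \<rho>1"

abbreviation calderon_space :: "real \<Rightarrow> ('a \<Rightarrow> real) set" where
  "calderon_space \<equiv> calderon M \<rho>0 \<rho>1"

lemma ambient_measurable [measurable_dest]: "f \<in> ambient \<Longrightarrow> f \<in> borel_measurable M"
  by (simp add: sum_space_def)

lemma ambientI:
  assumes [measurable]: "f \<in> borel_measurable M" and a: "a \<in> lat M \<rho>0" and b: "b \<in> lat M \<rho>1"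
    and dominated: "AE x in M. \<bar>f x\<bar> \<le> \<bar>a x\<bar> + \<bar>b x\<bar>"
  shows "f \<in> ambient"
proof -
  note [measurable] = L0.lat_measurable[OF a] L1.lat_measurable[OF b]
  let ?f0 = "\<lambda>x. max (- \<bar>a x\<bar>) (min (f x) \<bar>a x\<bar>)"
  have "?f0 \<in> lat M \<rho>0" by (rule L0.lat_solid[OF _ a]) auto
  moreover have "(\<lambda>x. f x - ?f0 x) \<in> lat M \<rho>1"
    by (rule L1.lat_solid[OF _ b]) (use dominated in \<open>auto elim!: eventually_mono\<close>)
  ultimately show ?thesis by (rule sum_spaceI[OF assms(1)]) simp
qed

lemma ambientE:
  assumes "f \<in> ambient"
  obtains a b where "a \<in> lat M \<rho>0" "b \<in> lat M \<rho>1" "\<And>x. 0 \<le> a x" "\<And>x. 0 \<le> b x"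
    "AE x in M. \<bar>f x\<bar> \<le> a x + b x"
proof -
  obtain f0 f1 where "f0 \<in> lat M \<rho>0" "f1 \<in> lat M \<rho>1" "AE x in M. f x = f0 x + f1 x"
    using assms by (rule sum_spaceE)
  then show ?thesis
    by (intro that[of "\<lambda>x. \<bar>f0 x\<bar>" "\<lambda>x. \<bar>f1 x\<bar>"] L0.lat_abs L1.lat_abs)
      (auto elim!: eventually_mono)
qed

lemma lat0_ambient: "f \<in> lat M \<rho>0 \<Longrightarrow> f \<in> ambient"
  by (rule ambientI[OF _ _ L1.zero_lat]) (auto simp: lat_def)

lemma lat1_ambient: "f \<in> lat M \<rho>1 \<Longrightarrow> f \<in> ambient"
  by (rule ambientI[OF _ L0.zero_lat]) (auto simp: lat_def)

lemma ambient_solid: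
  assumes "f \<in> borel_measurable M" "g \<in> ambient" "AE x in M. \<bar>f x\<bar> \<le> \<bar>g x\<bar>"
  shows "f \<in> ambient"
proof -
  obtain a b where ab: "a \<in> lat M \<rho>0" "b \<in> lat M \<rho>1" "\<And>x. 0 \<le> a x" "\<And>x. 0 \<le> b x"
    "AE x in M. \<bar>g x\<bar> \<le> a x + b x" using assms(2) by (rule ambientE) blast
  show ?thesis
    by (rule ambientI[OF assms(1) ab(1,2)])
      (use assms(3) ab(5) in eventually_elim, use ab(3,4) in auto)
qed

lemma ambient_lincomb:
  assumes f: "f \<in> ambient" and g: "g \<in> ambient"
  shows "(\<lambda>x. c * f x + d * g x) \<in> ambient"
proof -
  obtain f0 f1 where f01: "f0 \<in> lat M \<rho>0" "f1 \<in> lat M \<rho>1" "AE x in M. f x = f0 x + f1 x"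
    using f by (rule sum_spaceE)
  obtain g0 g1 where g01: "g0 \<in> lat M \<rho>0" "g1 \<in> lat M \<rho>1" "AE x in M. g x = g0 x + g1 x"
    using g by (rule sum_spaceE)
  show ?thesis
  proof (rule sum_spaceI)
    show "(\<lambda>x. c * f0 x + d * g0 x) \<in> lat M \<rho>0" "(\<lambda>x. c * f1 x + d * g1 x) \<in> lat M \<rho>1"
      by (intro L0.lat_add L0.lat_scale L1.lat_add L1.lat_scale f01 g01)+
    show "AE x in M. c * f x + d * g x = (c * f0 x + d * g0 x) + (c * f1 x + d * g1 x)"
      using f01(3) g01(3) by eventually_elim (simp add: algebra_simps)
  qed (use f g in measurable)
qed

lemma ambient_add: "f \<in> ambient \<Longrightarrow> g \<in> ambient \<Longrightarrow> (\<lambda>x. f x + g x) \<in> ambient"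
  using ambient_lincomb[of f g 1 1] by simp

lemma ambient_diff: "f \<in> ambient \<Longrightarrow> g \<in> ambient \<Longrightarrow> (\<lambda>x. f x - g x) \<in> ambient"
  using ambient_lincomb[of f g 1 "-1"] by simp

lemma ambient_scale: "f \<in> ambient \<Longrightarrow> (\<lambda>x. c * f x) \<in> ambient"
  using ambient_lincomb[of f f c 0] by simp

lemma ambient_abs: "f \<in> ambient \<Longrightarrow> (\<lambda>x. \<bar>f x\<bar>) \<in> ambient"
  by (rule ambient_solid[of _ f]) (auto dest: ambient_measurable)

lemma ambient_geom_mean:
  assumes f: "f \<in> ambient" and g: "g \<in> ambient" and \<theta>: "0 \<le> \<theta>" "\<theta> \<le> 1"
  shows "(\<lambda>x. geom_mean \<theta> (f x) (g x)) \<in> ambient"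
proof (rule ambient_solid[OF _ ambient_add[OF ambient_abs[OF f] ambient_abs[OF g]]])
  show "AE x in M. \<bar>geom_mean \<theta> (f x) (g x)\<bar> \<le> \<bar>\<bar>f x\<bar> + \<bar>g x\<bar>\<bar>"
    using geom_mean_le_add[OF \<theta>] by simp
qed (use ambient_measurable[OF f] ambient_measurable[OF g] in measurable)

lemma ex_positive_common:
  obtains u where "u \<in> lat M \<rho>0" "u \<in> lat M \<rho>1" "\<And>x. 0 \<le> u x" "AE x in M. 0 < u x"
proof -
  obtain a where a: "a \<in> lat M \<rho>0" "AE x in M. 0 < a x" using L0.ex_positive by blast
  obtain b where b: "b \<in> lat M \<rho>1" "AE x in M. 0 < b x" using L1.ex_positive by blast
  note [measurable] = L0.lat_measurable[OF a(1)] L1.lat_measurable[OF b(1)]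
  let ?u = "\<lambda>x. min \<bar>a x\<bar> \<bar>b x\<bar>"
  show ?thesis
  proof (rule that[of ?u])
    show "?u \<in> lat M \<rho>0" by (rule L0.lat_solid[OF _ a(1)]) auto
    show "?u \<in> lat M \<rho>1" by (rule L1.lat_solid[OF _ b(1)]) auto
    show "AE x in M. 0 < ?u x" using a(2) b(2) by eventually_elim auto
  qed auto
qed

lemma truncation_ambient:
  assumes "f \<in> ambient" "u \<in> ambient"
  shows "truncation u k f \<in> ambient"
proof (rule ambient_solid[OF _ ambient_lincomb[OF ambient_abs ambient_abs]])
  show "AE x in M. \<bar>truncation u k f x\<bar> \<le> \<bar>1 * \<bar>f x\<bar> + real k * \<bar>u x\<bar>\<bar>"
    by (intro AE_I2) (auto simp: truncation_def min_def abs_mult)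
qed (use assms ambient_measurable[OF assms(1)] ambient_measurable[OF assms(2)] in auto)

lemma decreasing_decomposition:
  assumes e: "\<And>n. e n \<in> ambient" and dec: "decreases_to_0 M e"
  obtains e0 e1 where "\<And>n. e0 n \<in> lat M \<rho>0" "decreases_to_0 M e0"
    "\<And>n. e1 n \<in> lat M \<rho>1" "decreases_to_0 M e1" "\<And>n x. e n x = e0 n x + e1 n x"
proof -
  obtain a b where ab: "a \<in> lat M \<rho>0" "b \<in> lat M \<rho>1" "\<And>x. 0 \<le> a x" "\<And>x. 0 \<le> b x"
    "AE x in M. \<bar>e 0 x\<bar> \<le> a x + b x" using e[of 0] by (rule ambientE) blast
  note [measurable] = ambient_measurable[OF e] L0.lat_measurable[OF ab(1)]
  define e0 where "e0 n x = min (e n x) (a x)" for n x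
  define e1 where "e1 n x = max 0 (e n x - a x)" for n x
  show ?thesis
  proof (rule that)
    show "decreases_to_0 M e0" "decreases_to_0 M e1"
      unfolding e0_def e1_def by (intro decreases_to_0_min decreases_to_0_excess dec ab(3))+
    show "e0 n \<in> lat M \<rho>0" for n
    proof (rule L0.lat_solid[OF _ ab(1)])
      show "AE x in M. \<bar>e0 n x\<bar> \<le> \<bar>a x\<bar>"
        using decreases_to_0_nonneg[OF dec]
        by eventually_elim (use ab(3) in \<open>auto simp: e0_def min_def\<close>)
    qed (unfold e0_def, measurable)
    show "e1 n \<in> lat M \<rho>1" for n
    proof (rule L1.lat_solid[OF _ ab(2)])
      show "AE x in M. \<bar>e1 n x\<bar> \<le> \<bar>b x\<bar>"
        using decreases_to_0_decseq[OF dec] ab(5)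
      proof eventually_elim
        case (elim x)
        then have "e n x \<le> e 0 x" by (auto dest: decseqD)
        then show ?case using elim ab(4)[of x] by (auto simp: e1_def max_def)
      qed
    qed (unfold e1_def, measurable)
    show "e n x = e0 n x + e1 n x" for n x by (simp add: e0_def e1_def min_def max_def)
  qed
qed

definition calderon_bound :: "real \<Rightarrow> ('a \<Rightarrow> real) \<Rightarrow> real \<Rightarrow> bool" where
  "calderon_bound \<theta> f l \<longleftrightarrow> (\<exists>f0\<in>unit_ball M \<rho>0. \<exists>f1\<in>unit_ball M \<rho>1.
     AE x in M. \<bar>f x\<bar> \<le> l * geom_mean \<theta> (f0 x) (f1 x))"

lemma calderon_boundI:
  assumes "f0 \<in> unit_ball M \<rho>0" "f1 \<in> unit_ball M \<rho>1"
    "AE x in M. \<bar>f x\<bar> \<le> l * geom_mean \<theta> (f0 x) (f1 x)"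
  shows "calderon_bound \<theta> f l"
  unfolding calderon_bound_def
  by (rule bexI[of _ f0], rule bexI[of _ f1]) (rule assms)+

lemma calderon_boundE:
  assumes "calderon_bound \<theta> f l"
  obtains f0 f1 where "f0 \<in> unit_ball M \<rho>0" "f1 \<in> unit_ball M \<rho>1"
    "AE x in M. \<bar>f x\<bar> \<le> l * geom_mean \<theta> (f0 x) (f1 x)"
  using assms unfolding calderon_bound_def by blast

lemma mem_calderon_iff:
  "f \<in> calderon_space \<theta> \<longleftrightarrow> f \<in> borel_measurable M \<and> (\<exists>l>0. calderon_bound \<theta> f l)"
  unfolding calderon_def lat_def calderon_norm_eq_geom_mean calderon_bound_def
  by (auto simp: Inf_less_iff)

lemma calderon_measurable [measurable_dest]: "f \<in> calderon_space \<theta> \<Longrightarrow> f \<in> borel_measurable M"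
  by (simp add: mem_calderon_iff)

lemma calderon_bound_mono:
  assumes "calderon_bound \<theta> f l" "AE x in M. \<bar>g x\<bar> \<le> c * \<bar>f x\<bar>" "0 \<le> c" "c * l \<le> l'"
  shows "calderon_bound \<theta> g l'"
proof -
  obtain f0 f1 where f01: "f0 \<in> unit_ball M \<rho>0" "f1 \<in> unit_ball M \<rho>1"
    "AE x in M. \<bar>f x\<bar> \<le> l * geom_mean \<theta> (f0 x) (f1 x)"
    using assms(1) by (rule calderon_boundE)
  have "AE x in M. \<bar>g x\<bar> \<le> l' * geom_mean \<theta> (f0 x) (f1 x)"
    using assms(2) f01(3)
  proof eventually_elim
    case (elim x)
    have "\<bar>g x\<bar> \<le> c * (l * geom_mean \<theta> (f0 x) (f1 x))"
      using elim assms(3) by (meson mult_left_mono order_trans)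
    also have "\<dots> \<le> l' * geom_mean \<theta> (f0 x) (f1 x)"
      using assms(4) by (simp add: mult.assoc[symmetric] mult_right_mono)
    finally show ?case .
  qed
  then show ?thesis by (rule calderon_boundI[OF f01(1,2)])
qed

lemma calderonI:
  assumes "f \<in> borel_measurable M" and a: "a \<in> lat M \<rho>0" and b: "b \<in> lat M \<rho>1"
    and dominated: "AE x in M. \<bar>f x\<bar> \<le> geom_mean \<theta> (a x) (b x)"
  shows "f \<in> calderon_space \<theta>"
proof -
  obtain c0 where c0: "0 < c0" "\<rho>0 a \<le> ennreal c0" by (rule L0.lat_norm_bound[OF a])
  obtain c1 where c1: "0 < c1" "\<rho>1 b \<le> ennreal c1" by (rule L1.lat_norm_bound[OF b])
  define m where "m = max c0 c1"
  have m: "0 < m" "\<rho>0 a \<le> ennreal m" "\<rho>1 b \<le> ennreal m"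
    using c0 c1 by (auto simp: m_def intro: order_trans ennreal_leI)
  have "(\<lambda>x. inverse m * a x) \<in> unit_ball M \<rho>0" "(\<lambda>x. inverse m * b x) \<in> unit_ball M \<rho>1"
    using m a b by (simp_all add: L0.scaled_in_unit_ball_iff L1.scaled_in_unit_ball_iff
        L0.lat_measurable L1.lat_measurable)
  moreover have "AE x in M. \<bar>f x\<bar> \<le> m * geom_mean \<theta> (inverse m * a x) (inverse m * b x)"
    using dominated m(1) by (simp add: geom_mean_scale mult.assoc[symmetric])
  ultimately have "calderon_bound \<theta> f m" by (rule calderon_boundI)
  then show ?thesis using assms(1) m(1) by (auto simp: mem_calderon_iff)
qed

lemma calderonE:
  assumes "f \<in> calderon_space \<theta>"
  obtains a b where "a \<in> lat M \<rho>0" "b \<in> lat M \<rho>1" "AE x in M. \<bar>f x\<bar> \<le> geom_mean \<theta> (a x) (b x)"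
proof -
  obtain l where l: "0 < l" "calderon_bound \<theta> f l" using assms mem_calderon_iff by blast
  obtain f0 f1 where "f0 \<in> unit_ball M \<rho>0" "f1 \<in> unit_ball M \<rho>1"
    "AE x in M. \<bar>f x\<bar> \<le> l * geom_mean \<theta> (f0 x) (f1 x)" using l(2) by (rule calderon_boundE)
  with l(1) show ?thesis
    by (intro that[of "\<lambda>x. l * f0 x" "\<lambda>x. l * f1 x"] L0.lat_scale L1.lat_scale
        L0.unit_ball_lat L1.unit_ball_lat) (simp_all add: geom_mean_scale)
qed

lemma calderon_subset_ambient:
  assumes \<theta>: "0 \<le> \<theta>" "\<theta> \<le> 1"
  shows "calderon_space \<theta> \<subseteq> ambient"
proof
  fix f assume f: "f \<in> calderon_space \<theta>"
  then obtain a b where ab: "a \<in> lat M \<rho>0" "b \<in> lat M \<rho>1"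
    "AE x in M. \<bar>f x\<bar> \<le> geom_mean \<theta> (a x) (b x)" by (rule calderonE)
  show "f \<in> ambient"
    by (rule ambientI[OF calderon_measurable[OF f] ab(1,2)])
      (use ab(3) in eventually_elim, use geom_mean_le_add[OF \<theta>] in \<open>blast intro: order_trans\<close>)
qed

lemma calderon_solid:
  assumes "g \<in> borel_measurable M" "f \<in> calderon_space \<theta>" "AE x in M. \<bar>g x\<bar> \<le> \<bar>f x\<bar>"
  shows "g \<in> calderon_space \<theta>"
proof -
  obtain a b where ab: "a \<in> lat M \<rho>0" "b \<in> lat M \<rho>1" "AE x in M. \<bar>f x\<bar> \<le> geom_mean \<theta> (a x) (b x)"
    using assms(2) by (rule calderonE)
  show ?thesis
    by (rule calderonI[OF assms(1) ab(1,2)]) (use assms(3) ab(3) in eventually_elim, simp)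
qed

lemma lat_Int_calderon: "f \<in> lat M \<rho>0 \<Longrightarrow> f \<in> lat M \<rho>1 \<Longrightarrow> f \<in> calderon_space \<theta>"
  by (rule calderonI[of f f f]) (auto simp: lat_def)

lemma truncation_calderon:
  assumes "f \<in> borel_measurable M" "AE x in M. 0 \<le> f x" "u \<in> lat M \<rho>0" "u \<in> lat M \<rho>1" "\<And>x. 0 \<le> u x"
  shows "truncation u k f \<in> calderon_space \<theta>"
  using assms by (intro lat_Int_calderon L0.lat_truncation L1.lat_truncation)

lemma calderon_lincomb:
  assumes f: "f \<in> calderon_space \<theta>" and g: "g \<in> calderon_space \<theta>" and \<theta>: "0 \<le> \<theta>" "\<theta> \<le> 1"
  shows "(\<lambda>x. c * f x + d * g x) \<in> calderon_space \<theta>"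
proof -
  obtain a b where ab: "a \<in> lat M \<rho>0" "b \<in> lat M \<rho>1"
    "AE x in M. \<bar>f x\<bar> \<le> geom_mean \<theta> (a x) (b x)" using f by (rule calderonE)
  obtain a' b' where ab': "a' \<in> lat M \<rho>0" "b' \<in> lat M \<rho>1"
    "AE x in M. \<bar>g x\<bar> \<le> geom_mean \<theta> (a' x) (b' x)" using g by (rule calderonE)
  define k where "k = \<bar>c\<bar> + \<bar>d\<bar>"
  show ?thesis
  proof (rule calderonI)
    show "(\<lambda>x. k * (\<bar>a x\<bar> + \<bar>a' x\<bar>)) \<in> lat M \<rho>0" "(\<lambda>x. k * (\<bar>b x\<bar> + \<bar>b' x\<bar>)) \<in> lat M \<rho>1"
      by (intro L0.lat_scale L0.lat_add L0.lat_abs L1.lat_scale L1.lat_add L1.lat_abs ab ab')+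
    show "AE x in M. \<bar>c * f x + d * g x\<bar>
        \<le> geom_mean \<theta> (k * (\<bar>a x\<bar> + \<bar>a' x\<bar>)) (k * (\<bar>b x\<bar> + \<bar>b' x\<bar>))"
      using ab(3) ab'(3)
    proof eventually_elim
      case (elim x)
      let ?R = "geom_mean \<theta> (\<bar>a x\<bar> + \<bar>a' x\<bar>) (\<bar>b x\<bar> + \<bar>b' x\<bar>)"
      have "\<bar>c * f x + d * g x\<bar> \<le> \<bar>c\<bar> * \<bar>f x\<bar> + \<bar>d\<bar> * \<bar>g x\<bar>"
        by (rule order_trans[OF abs_triangle_ineq]) (simp add: abs_mult)
      also have "\<dots> \<le> \<bar>c\<bar> * ?R + \<bar>d\<bar> * ?R"
        using \<theta> by (intro add_mono mult_left_mono order_trans[OF elim(1)] order_trans[OF elim(2)]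
            geom_mean_mono) auto
      also have "\<dots> = geom_mean \<theta> (k * (\<bar>a x\<bar> + \<bar>a' x\<bar>)) (k * (\<bar>b x\<bar> + \<bar>b' x\<bar>))"
        by (subst geom_mean_scale) (simp add: k_def distrib_right)
      finally show ?case .
    qed
    show "(\<lambda>x. c * f x + d * g x) \<in> borel_measurable M" using f g by measurable
  qed
qed

lemma calderon_common_bound:
  assumes g: "\<And>n. calderon_bound \<theta> (g n) 1" and \<theta>: "0 \<le> \<theta>" "\<theta> \<le> 1"
  obtains q where "q \<in> calderon_space \<theta>" "\<And>n. AE x in M. \<bar>g n x\<bar> \<le> 2 ^ n * q x"
proof -
  obtain a b where a: "\<And>n. a n \<in> unit_ball M \<rho>0" and b: "\<And>n. b n \<in> unit_ball M \<rho>1"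
    and dominated: "\<And>n. AE x in M. \<bar>g n x\<bar> \<le> geom_mean \<theta> (a n x) (b n x)"
    using g unfolding calderon_bound_def by (simp add: Bex_def) metis
  obtain A where A: "A \<in> lat M \<rho>0" "\<And>n. AE x in M. \<bar>a n x\<bar> \<le> 2 ^ n * \<bar>A x\<bar>"
    using L0.unit_ball_common_bound a by blast
  obtain B where B: "B \<in> lat M \<rho>1" "\<And>n. AE x in M. \<bar>b n x\<bar> \<le> 2 ^ n * \<bar>B x\<bar>"
    using L1.unit_ball_common_bound b by blast
  show ?thesis
  proof (rule that)
    show "(\<lambda>x. geom_mean \<theta> (A x) (B x)) \<in> calderon_space \<theta>"
      by (rule calderonI[OF _ A(1) B(1)])
        (use L0.lat_measurable[OF A(1)] L1.lat_measurable[OF B(1)] in simp_all)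
    show "AE x in M. \<bar>g n x\<bar> \<le> 2 ^ n * geom_mean \<theta> (A x) (B x)" for n
      using dominated[of n] A(2)[of n] B(2)[of n]
    proof eventually_elim
      case (elim x)
      have "geom_mean \<theta> (a n x) (b n x) \<le> geom_mean \<theta> (2 ^ n * A x) (2 ^ n * B x)"
        using elim \<theta> by (intro geom_mean_mono) (auto simp: abs_mult)
      then show ?case using elim(1) by (simp add: geom_mean_scale)
    qed
  qed
qed

end

section \<open>Cancellation of a factor of a Calderon product\<close>

definition domination_set :: "'a measure \<Rightarrow> ('a \<Rightarrow> real) \<Rightarrow> ('a \<Rightarrow> real) \<Rightarrow> nat \<Rightarrow> 'a set" where
  "domination_set M B h n = {x \<in> space M. 0 < h x \<and> \<bar>B x\<bar> \<le> 2 ^ n * h x}"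

lemma domination_set_measurable:
  assumes [measurable]: "B \<in> borel_measurable M" "h \<in> borel_measurable M"
  shows "domination_set M B h n \<in> sets M"
  unfolding domination_set_def by measurable

lemma domination_set_mono:
  assumes "m \<le> n"
  shows "domination_set M B h m \<subseteq> domination_set M B h n"
proof
  fix x assume x: "x \<in> domination_set M B h m"
  then have "\<bar>B x\<bar> \<le> 2 ^ m * h x" by (simp add: domination_set_def)
  also have "\<dots> \<le> 2 ^ n * h x" using x assms by (simp add: domination_set_def)
  finally show "x \<in> domination_set M B h n" using x by (simp add: domination_set_def)
qed

lemma AE_mem_domination_set:
  assumes "AE x in M. 0 < h x"
  shows "AE x in M. x \<in> (\<Union>n. domination_set M B h (Suc n))"
  using assms AE_space
proof eventually_elim
  case (elim x)
  obtain k where "\<bar>B x\<bar> / h x < 2 ^ k" using real_arch_pow[of 2 "\<bar>B x\<bar> / h x"] by auto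
  then have "x \<in> domination_set M B h k" using elim by (simp add: domination_set_def field_simps)
  then show ?case using domination_set_mono[of k "Suc k" M B h] by auto
qed

lemma (in function_lattice) norm_indicator_le_of_chain:
  assumes f [measurable]: "f \<in> borel_measurable M" and A [measurable]: "A \<in> sets M"
    and a: "\<And>i. a i \<in> unit_ball M \<rho>"
    and \<theta>: "0 < \<theta>" "\<theta> < 1" and C: "0 < C" and c: "0 < c" and n: "0 < n"
    and chain: "AE x in M. \<forall>i. geom_mean \<theta> (f x) (h i x) \<le> C * geom_mean \<theta> (a i x) (h (Suc i) x)"
    and ratio: "AE x in M. x \<in> A \<longrightarrow> 0 < h 0 x \<and> \<bar>h n x\<bar> \<le> c ^ n * h 0 x"
  shows "\<rho> (\<lambda>x. indicator A x * \<bar>f x\<bar>) \<le> ennreal ((C * c powr \<theta>) powr (1 / (1 - \<theta>)))"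
proof -
  note [measurable] = unit_ball_measurable[OF a]
  let ?K = "(C * c powr \<theta>) powr (1 / (1 - \<theta>))"
  let ?mean = "\<lambda>x. inverse (real n) * (\<Sum>i<n. \<bar>a i x\<bar>)"
  have "AE x in M. \<bar>indicator A x * \<bar>f x\<bar>\<bar> \<le> \<bar>?K * ?mean x\<bar>"
    using chain ratio
  proof eventually_elim
    case (elim x)
    have "0 \<le> ?K * ?mean x" by (intro mult_nonneg_nonneg sum_nonneg) auto
    moreover have "\<bar>f x\<bar> \<le> ?K * ?mean x" if "x \<in> A"
      using elim that by (intro abs_le_arith_mean_of_chain[OF \<theta> C c n, where h = "\<lambda>i. h i x"]) auto
    ultimately show ?case by (cases "x \<in> A") simp_all
  qed
  then have "\<rho> (\<lambda>x. indicator A x * \<bar>f x\<bar>) \<le> \<rho> (\<lambda>x. ?K * ?mean x)"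
    by (intro norm_mono) measurable
  also have "\<dots> = ennreal ?K * \<rho> ?mean" by (subst norm_scale) auto
  also have "\<dots> \<le> ennreal ?K * 1"
    by (intro mult_left_mono unit_ball_norm arith_mean_unit_ball a n) simp
  finally show ?thesis by simp
qed

context lattice_couple
begin

lemma ex_factor_chain:
  assumes h0: "h0 \<in> unit_ball M \<rho>1"
    and factor: "\<And>h. h \<in> unit_ball M \<rho>1 \<Longrightarrow> calderon_bound \<theta> (\<lambda>x. geom_mean \<theta> (f x) (h x)) C"
  obtains a h where "h 0 = h0" "\<And>i::nat. a i \<in> unit_ball M \<rho>0" "\<And>i. h i \<in> unit_ball M \<rho>1"
    "AE x in M. \<forall>i. geom_mean \<theta> (f x) (h i x) \<le> C * geom_mean \<theta> (a i x) (h (Suc i) x)"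
proof -
  have "\<forall>h. \<exists>a b. h \<in> unit_ball M \<rho>1 \<longrightarrow> a \<in> unit_ball M \<rho>0 \<and> b \<in> unit_ball M \<rho>1 \<and>
      (AE x in M. geom_mean \<theta> (f x) (h x) \<le> C * geom_mean \<theta> (a x) (b x))"
    using factor unfolding calderon_bound_def abs_geom_mean by blast
  then obtain F0 F1 where F: "\<And>h. h \<in> unit_ball M \<rho>1 \<Longrightarrow>
      F0 h \<in> unit_ball M \<rho>0 \<and> F1 h \<in> unit_ball M \<rho>1 \<and>
      (AE x in M. geom_mean \<theta> (f x) (h x) \<le> C * geom_mean \<theta> (F0 h x) (F1 h x))"
    unfolding choice_iff by blast
  define h where "h i = (F1 ^^ i) h0" for i
  have h: "h i \<in> unit_ball M \<rho>1" for i
    by (induction i) (use h0 F in \<open>auto simp: h_def\<close>)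
  have "AE x in M. geom_mean \<theta> (f x) (h i x) \<le> C * geom_mean \<theta> (F0 (h i) x) (h (Suc i) x)" for i
    using F[OF h[of i]] by (simp add: h_def)
  then show ?thesis
    using F h by (intro that[of h "\<lambda>i. F0 (h i)"]) (auto simp: h_def AE_all_countable)
qed

text \<open>With \<open>h\<^sub>0\<close> strictly positive and \<open>B\<close> a common bound of the \<open>h\<^sub>n / 2\<^sup>n\<close>, the ratio \<open>h\<^sub>n / h\<^sub>0\<close>
  is at most \<open>4\<^sup>n\<close> where \<open>B \<le> 2\<^sup>n h\<^sub>0\<close>; the \<open>n\<close>-th root of this bound does not depend on \<open>n\<close>.\<close>
lemma norm_bound_of_factorization:
  assumes fatou: "fatou M \<rho>0" and f [measurable]: "f \<in> borel_measurable M"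
    and C: "0 < C" and \<theta>: "0 < \<theta>" "\<theta> < 1"
    and factor: "\<And>h. h \<in> unit_ball M \<rho>1 \<Longrightarrow> calderon_bound \<theta> (\<lambda>x. geom_mean \<theta> (f x) (h x)) C"
  shows "\<rho>0 f \<le> ennreal ((C * 4 powr \<theta>) powr (1 / (1 - \<theta>)))"
proof -
  obtain h0 where h0: "h0 \<in> unit_ball M \<rho>1" "AE x in M. 0 < h0 x" by (rule L1.ex_positive_unit_ball)
  obtain a h where start: "h 0 = h0"
    and a: "\<And>i::nat. a i \<in> unit_ball M \<rho>0" and h: "\<And>i. h i \<in> unit_ball M \<rho>1"
    and chain: "AE x in M. \<forall>i. geom_mean \<theta> (f x) (h i x) \<le> C * geom_mean \<theta> (a i x) (h (Suc i) x)"
    using ex_factor_chain[OF h0(1) factor] by blast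
  obtain B where B: "B \<in> lat M \<rho>1" "\<And>n. AE x in M. \<bar>h n x\<bar> \<le> 2 ^ n * \<bar>B x\<bar>"
    using L1.unit_ball_common_bound h by blast
  let ?\<Omega> = "\<lambda>n. domination_set M B h0 (Suc n)"
  have \<Omega>: "?\<Omega> n \<in> sets M" for n
    by (intro domination_set_measurable L1.lat_measurable[OF B(1)] L1.unit_ball_measurable[OF h0(1)])
  have bound: "\<rho>0 (\<lambda>x. indicator (?\<Omega> n) x * \<bar>f x\<bar>)
      \<le> ennreal ((C * 4 powr \<theta>) powr (1 / (1 - \<theta>)))" for n
  proof (rule L0.norm_indicator_le_of_chain[OF f \<Omega> a \<theta> C _ _ chain])
    show "AE x in M. x \<in> ?\<Omega> n \<longrightarrow> 0 < h 0 x \<and> \<bar>h (Suc n) x\<bar> \<le> 4 ^ Suc n * h 0 x"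
      using B(2)[of "Suc n"]
    proof (eventually_elim, intro impI conjI)
      fix x assume hx: "\<bar>h (Suc n) x\<bar> \<le> 2 ^ Suc n * \<bar>B x\<bar>" and "x \<in> ?\<Omega> n"
      then have x: "0 < h 0 x" "\<bar>B x\<bar> \<le> 2 ^ Suc n * h 0 x"
        by (simp_all add: domination_set_def start)
      show "0 < h 0 x" by (rule x(1))
      have "\<bar>h (Suc n) x\<bar> \<le> 2 ^ Suc n * (2 ^ Suc n * h 0 x)"
        by (intro order_trans[OF hx] mult_left_mono x(2)) simp
      also have "\<dots> = 4 ^ Suc n * h 0 x"
        by (simp add: mult.assoc[symmetric] power_mult_distrib[symmetric])
      finally show "\<bar>h (Suc n) x\<bar> \<le> 4 ^ Suc n * h 0 x" .
    qed
  qed auto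
  have "incseq ?\<Omega>" by (intro monoI domination_set_mono) simp
  then show ?thesis
    by (rule L0.norm_le_of_exhaustion[OF fatou f \<Omega> _ AE_mem_domination_set[OF h0(2)] bound])
qed

end

section \<open>Positive operators on couples\<close>

locale positive_operator =
  X: lattice_couple M \<rho>0 \<rho>1 + Y: lattice_couple N \<sigma>0 \<sigma>1
  for M :: "'a measure" and \<rho>0 \<rho>1 :: "('a \<Rightarrow> real) \<Rightarrow> ennreal"
    and N :: "'b measure" and \<sigma>0 \<sigma>1 :: "('b \<Rightarrow> real) \<Rightarrow> ennreal" +
  fixes T :: "('a \<Rightarrow> real) \<Rightarrow> ('b \<Rightarrow> real)"
  assumes admissible: "admissible_positive_op M \<rho>0 \<rho>1 N \<sigma>0 \<sigma>1 T"
begin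

lemma T_ambient: "f \<in> X.ambient \<Longrightarrow> T f \<in> Y.ambient"
  and T_cong: "f \<in> X.ambient \<Longrightarrow> g \<in> X.ambient \<Longrightarrow> AE x in M. f x = g x \<Longrightarrow> AE y in N. T f y = T g y"
  and T_lincomb: "f \<in> X.ambient \<Longrightarrow> g \<in> X.ambient \<Longrightarrow>
    AE y in N. T (\<lambda>x. c * f x + d * g x) y = c * T f y + d * T g y"
  and T_nonneg: "f \<in> X.ambient \<Longrightarrow> AE x in M. 0 \<le> f x \<Longrightarrow> AE y in N. 0 \<le> T f y"
  and T_bounded0: "\<exists>C. \<forall>f \<in> lat M \<rho>0. \<sigma>0 (T f) \<le> ennreal C * \<rho>0 f"
  using admissible unfolding admissible_positive_op_def by (blast+)

lemma T_measurable: "f \<in> X.ambient \<Longrightarrow> T f \<in> borel_measurable N"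
  by (intro Y.ambient_measurable T_ambient)

lemma T_add:
  "f \<in> X.ambient \<Longrightarrow> g \<in> X.ambient \<Longrightarrow> AE y in N. T (\<lambda>x. f x + g x) y = T f y + T g y"
  using T_lincomb[of f g 1 1] by simp

lemma T_diff:
  "f \<in> X.ambient \<Longrightarrow> g \<in> X.ambient \<Longrightarrow> AE y in N. T (\<lambda>x. f x - g x) y = T f y - T g y"
  using T_lincomb[of f g 1 "-1"] by simp

lemma T_scale: "f \<in> X.ambient \<Longrightarrow> AE y in N. T (\<lambda>x. c * f x) y = c * T f y"
  using T_lincomb[of f f c 0] by simp

lemma T_eq_0: "f \<in> X.ambient \<Longrightarrow> AE x in M. f x = 0 \<Longrightarrow> AE y in N. T f y = 0"
  using T_cong[of f "\<lambda>x. 0 * f x"] T_scale[of f 0] X.ambient_scale[of f 0] by auto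

lemma T_mono:
  assumes f: "f \<in> X.ambient" and g: "g \<in> X.ambient" and f_le_g: "AE x in M. f x \<le> g x"
  shows "AE y in N. T f y \<le> T g y"
proof -
  have "AE y in N. 0 \<le> T (\<lambda>x. g x - f x) y"
    by (rule T_nonneg[OF X.ambient_diff[OF g f]]) (use f_le_g in \<open>auto elim!: eventually_mono\<close>)
  then show ?thesis using T_diff[OF g f] by eventually_elim auto
qed

lemma T_abs_nonneg: "f \<in> X.ambient \<Longrightarrow> AE y in N. 0 \<le> T (\<lambda>x. \<bar>f x\<bar>) y"
  by (intro T_nonneg X.ambient_abs) auto

lemma T_abs_le:
  assumes f: "f \<in> X.ambient"
  shows "AE y in N. \<bar>T f y\<bar> \<le> T (\<lambda>x. \<bar>f x\<bar>) y"
proof -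
  note abs_f = X.ambient_abs[OF f]
  have "AE y in N. T f y \<le> T (\<lambda>x. \<bar>f x\<bar>) y" by (rule T_mono[OF f abs_f]) auto
  moreover have "AE y in N. T (\<lambda>x. - 1 * f x) y \<le> T (\<lambda>x. \<bar>f x\<bar>) y"
    by (rule T_mono[OF X.ambient_scale[OF f] abs_f]) auto
  ultimately show ?thesis using T_scale[OF f, of "-1"] by eventually_elim auto
qed

text \<open>The geometric mean is the infimum of countably many linear functions, so that the exceptional
  sets add up to a null set.\<close>
lemma T_geom_mean_le:
  assumes f: "f \<in> X.ambient" and g: "g \<in> X.ambient" and \<theta>: "0 < \<theta>" "\<theta> < 1"
  shows "AE y in N. T (\<lambda>x. geom_mean \<theta> (f x) (g x)) y
    \<le> geom_mean \<theta> (T (\<lambda>x. \<bar>f x\<bar>) y) (T (\<lambda>x. \<bar>g x\<bar>) y)"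
proof -
  let ?h = "\<lambda>x. geom_mean \<theta> (f x) (g x)"
  note abs_f = X.ambient_abs[OF f] and abs_g = X.ambient_abs[OF g]
  have h: "?h \<in> X.ambient" using f g \<theta> by (intro X.ambient_geom_mean) auto
  have "AE y in N. T ?h y \<le> (1 - \<theta>) * exp (\<theta> * q) * T (\<lambda>x. \<bar>f x\<bar>) y
      + \<theta> * exp ((\<theta> - 1) * q) * T (\<lambda>x. \<bar>g x\<bar>) y" for q :: real
  proof -
    have "AE y in N. T ?h y
        \<le> T (\<lambda>x. ((1 - \<theta>) * exp (\<theta> * q)) * \<bar>f x\<bar> + (\<theta> * exp ((\<theta> - 1) * q)) * \<bar>g x\<bar>) y"
      using \<theta> by (intro T_mono[OF h X.ambient_lincomb[OF abs_f abs_g]] AE_I2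
          geom_mean_le_weighted_sum) auto
    then show ?thesis
      using T_lincomb[OF abs_f abs_g, of "(1 - \<theta>) * exp (\<theta> * q)" "\<theta> * exp ((\<theta> - 1) * q)"]
      by eventually_elim auto
  qed
  then have "AE y in N. \<forall>q\<in>\<rat>. T ?h y \<le> (1 - \<theta>) * exp (\<theta> * q) * T (\<lambda>x. \<bar>f x\<bar>) y
      + \<theta> * exp ((\<theta> - 1) * q) * T (\<lambda>x. \<bar>g x\<bar>) y"
    by (subst AE_ball_countable[OF countable_rat]) auto
  then show ?thesis
    using T_abs_nonneg[OF f] T_abs_nonneg[OF g]
    by eventually_elim (intro le_geom_mean_of_rational_bounds \<theta>; simp)
qed

lemma T_bound0:
  obtains C where "0 < C" "\<And>f. f \<in> lat M \<rho>0 \<Longrightarrow> \<sigma>0 (T f) \<le> ennreal C * \<rho>0 f"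
proof -
  obtain C where C: "\<forall>f \<in> lat M \<rho>0. \<sigma>0 (T f) \<le> ennreal C * \<rho>0 f" using T_bounded0 by blast
  show ?thesis
  proof (rule that[of "max 1 C"])
    fix f assume "f \<in> lat M \<rho>0"
    then have "\<sigma>0 (T f) \<le> ennreal C * \<rho>0 f" using C by blast
    also have "\<dots> \<le> ennreal (max 1 C) * \<rho>0 f" by (intro mult_right_mono ennreal_leI) auto
    finally show "\<sigma>0 (T f) \<le> ennreal (max 1 C) * \<rho>0 f" .
  qed simp
qed

lemma T_lat0:
  assumes f: "f \<in> lat M \<rho>0"
  shows "T f \<in> lat N \<sigma>0"
proof -
  obtain C where "\<And>f. f \<in> lat M \<rho>0 \<Longrightarrow> \<sigma>0 (T f) \<le> ennreal C * \<rho>0 f" using T_bound0 by blast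
  then have "\<sigma>0 (T f) \<le> ennreal C * \<rho>0 f" using f by blast
  also have "\<dots> < \<infinity>" using X.L0.lat_finite[OF f] by (simp add: ennreal_mult_less_top)
  finally show ?thesis using T_measurable[OF X.lat0_ambient[OF f]] by (simp add: lat_def)
qed

lemma positive_operator_swap: "positive_operator M \<rho>1 \<rho>0 N \<sigma>1 \<sigma>0 T"
proof unfold_locales
  show "admissible_positive_op M \<rho>1 \<rho>0 N \<sigma>1 \<sigma>0 T"
    using admissible unfolding admissible_positive_op_def
    by (simp only: sum_space_commute[of M \<rho>1 \<rho>0] sum_space_commute[of N \<sigma>1 \<sigma>0]) blast
qed

lemmas T_bound1 = positive_operator.T_bound0[OF positive_operator_swap]
  and T_lat1 = positive_operator.T_lat0[OF positive_operator_swap]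

lemma T_bound:
  obtains C where "0 < C" "\<And>f. f \<in> lat M \<rho>0 \<Longrightarrow> \<sigma>0 (T f) \<le> ennreal C * \<rho>0 f"
    "\<And>f. f \<in> lat M \<rho>1 \<Longrightarrow> \<sigma>1 (T f) \<le> ennreal C * \<rho>1 f"
proof -
  obtain C0 where C0: "0 < C0" "\<And>f. f \<in> lat M \<rho>0 \<Longrightarrow> \<sigma>0 (T f) \<le> ennreal C0 * \<rho>0 f"
    using T_bound0 by blast
  obtain C1 where C1: "\<And>f. f \<in> lat M \<rho>1 \<Longrightarrow> \<sigma>1 (T f) \<le> ennreal C1 * \<rho>1 f"
    using T_bound1 by blast
  have le_max: "ennreal C0 * z \<le> ennreal (max C0 C1) * z"
    "ennreal C1 * z \<le> ennreal (max C0 C1) * z" for z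
    by (intro mult_right_mono ennreal_leI; simp)+
  show ?thesis
    by (rule that[of "max C0 C1"])
      (use C0(1) in \<open>auto intro: order_trans[OF C0(2) le_max(1)] order_trans[OF C1 le_max(2)]\<close>)
qed

lemma T_calderon:
  assumes f: "f \<in> X.calderon_space \<theta>" and \<theta>: "0 < \<theta>" "\<theta> < 1"
  shows "T f \<in> Y.calderon_space \<theta>"
proof -
  obtain a b where ab: "a \<in> lat M \<rho>0" "b \<in> lat M \<rho>1"
    "AE x in M. \<bar>f x\<bar> \<le> geom_mean \<theta> (a x) (b x)" using f by (rule X.calderonE)
  have f_ambient: "f \<in> X.ambient" using X.calderon_subset_ambient[of \<theta>] \<theta> f by auto
  note a_ambient = X.lat0_ambient[OF ab(1)] and b_ambient = X.lat1_ambient[OF ab(2)]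
  show ?thesis
  proof (rule Y.calderonI[OF T_measurable[OF f_ambient]])
    show "T (\<lambda>x. \<bar>a x\<bar>) \<in> lat N \<sigma>0" "T (\<lambda>x. \<bar>b x\<bar>) \<in> lat N \<sigma>1"
      by (intro T_lat0 T_lat1 X.L0.lat_abs X.L1.lat_abs ab)+
    have "AE y in N. T (\<lambda>x. \<bar>f x\<bar>) y \<le> T (\<lambda>x. geom_mean \<theta> (a x) (b x)) y"
      using \<theta>
      by (intro T_mono X.ambient_abs X.ambient_geom_mean f_ambient a_ambient b_ambient ab(3)) auto
    then show "AE y in N. \<bar>T f y\<bar> \<le> geom_mean \<theta> (T (\<lambda>x. \<bar>a x\<bar>) y) (T (\<lambda>x. \<bar>b x\<bar>) y)"
      using T_abs_le[OF f_ambient] T_geom_mean_le[OF a_ambient b_ambient \<theta>]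
      by eventually_elim linarith
  qed
qed

lemma T_converges0:
  assumes f: "\<And>n. f n \<in> lat M \<rho>0" "f' \<in> lat M \<rho>0" and lim: "X.L0.converges f f'"
  shows "Y.L0.converges (\<lambda>n. T (f n)) (T f')"
proof -
  obtain C where C: "\<And>f. f \<in> lat M \<rho>0 \<Longrightarrow> \<sigma>0 (T f) \<le> ennreal C * \<rho>0 f" using T_bound0 by blast
  have bound: "\<sigma>0 (\<lambda>y. T (f n) y - T f' y) \<le> ennreal C * \<rho>0 (\<lambda>x. f n x - f' x)" for n
  proof -
    note diff_lat = X.L0.lat_diff[OF f(1)[of n] f(2)]
    note in_ambient = X.lat0_ambient[OF f(1)[of n]] X.lat0_ambient[OF f(2)]
    have "\<sigma>0 (\<lambda>y. T (f n) y - T f' y) = \<sigma>0 (T (\<lambda>x. f n x - f' x))"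
      by (rule Y.L0.norm_cong)
        (use T_diff[OF in_ambient] T_measurable in_ambient X.lat0_ambient[OF diff_lat] in auto)
    then show ?thesis using C[OF diff_lat] by simp
  qed
  have "(\<lambda>n. ennreal C * \<rho>0 (\<lambda>x. f n x - f' x)) \<longlonglongrightarrow> 0"
    using ennreal_tendsto_cmult[OF _ lim[unfolded X.L0.converges_def], of "ennreal C"] by simp
  then show ?thesis
    unfolding Y.L0.converges_def
    by (rule tendsto_sandwich[OF _ _ tendsto_const, rotated 2]) (simp_all add: bound)
qed

lemma T_preimage_of_limit0:
  assumes f: "\<And>n. f n \<in> lat M \<rho>0" and g: "g \<in> borel_measurable N"
    and Tf: "Y.L0.converges (\<lambda>n. T (f n)) g"
    and incr: "\<And>k n. \<rho>0 (\<lambda>x. f (k + n) x - f k x) \<le> e k" and e: "e \<longlonglongrightarrow> 0"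
  obtains f' where "f' \<in> lat M \<rho>0" "AE y in N. T f' y = g y"
proof -
  obtain f' where f': "f' \<in> lat M \<rho>0" "X.L0.converges f f'"
    using X.L0.converges_of_increments[OF f incr e] by blast
  have "AE y in N. T f' y = g y"
    by (rule Y.L0.converges_unique[OF T_converges0[OF f f'] Tf])
      (use f f'(1) g in \<open>auto intro: T_measurable X.lat0_ambient\<close>)
  then show ?thesis using f'(1) that by blast
qed

end

section \<open>Order continuity\<close>

context positive_operator
begin

lemma T_tendsto_0_lat0:
  assumes reg: "regular M \<rho>0" and e: "\<And>n. e n \<in> lat M \<rho>0" and dec: "decreases_to_0 M e"
  shows "AE y in N. (\<lambda>n. T (e n) y) \<longlonglongrightarrow> 0"
proof -
  note e_ambient = X.lat0_ambient[OF e]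
  obtain C where C: "\<And>f. f \<in> lat M \<rho>0 \<Longrightarrow> \<sigma>0 (T f) \<le> ennreal C * \<rho>0 f" using T_bound0 by blast
  have "(\<lambda>n. ennreal C * \<rho>0 (e n)) \<longlonglongrightarrow> 0"
    using ennreal_tendsto_cmult[OF _ X.L0.norm_tendsto_0_of_decreasing[OF reg e dec], of "ennreal C"]
    by simp
  moreover have "AE y in N. \<forall>n. 0 \<le> T (e n) y"
    unfolding AE_all_countable
    using decreases_to_0_nonneg[OF dec]
    by (intro allI T_nonneg[OF e_ambient]) (simp add: AE_all_countable)
  moreover have "AE y in N. \<forall>n. T (e (Suc n)) y \<le> T (e n) y"
    unfolding AE_all_countable
    using decreases_to_0_decseq[OF dec]
    by (intro allI T_mono[OF e_ambient e_ambient]) (auto dest: decseq_SucD elim!: eventually_mono)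
  then have "AE y in N. decseq (\<lambda>n. T (e n) y)"
    by eventually_elim (simp add: decseq_SucI)
  ultimately show ?thesis
    by (intro Y.L0.AE_tendsto_0_of_decreasing[where a = "\<lambda>n. ennreal C * \<rho>0 (e n)"]
        T_measurable[OF e_ambient] C e)
qed

lemmas T_tendsto_0_lat1 = positive_operator.T_tendsto_0_lat0[OF positive_operator_swap]

lemma T_tendsto_0:
  assumes reg: "regular M \<rho>0" "regular M \<rho>1"
    and e: "\<And>n. e n \<in> X.ambient" and dec: "decreases_to_0 M e"
  shows "AE y in N. (\<lambda>n. T (e n) y) \<longlonglongrightarrow> 0"
proof -
  obtain e0 e1 where e0: "\<And>n. e0 n \<in> lat M \<rho>0" "decreases_to_0 M e0"
    and e1: "\<And>n. e1 n \<in> lat M \<rho>1" "decreases_to_0 M e1"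
    and e_eq: "\<And>n x. e n x = e0 n x + e1 n x"
    using X.decreasing_decomposition[OF e dec] by blast
  have "AE y in N. T (e n) y = T (e0 n) y + T (e1 n) y" for n
  proof -
    have "e n = (\<lambda>x. e0 n x + e1 n x)" by (rule ext) (rule e_eq)
    then show ?thesis using T_add[OF X.lat0_ambient[OF e0(1)] X.lat1_ambient[OF e1(1)]] by simp
  qed
  then have "AE y in N. \<forall>n. T (e n) y = T (e0 n) y + T (e1 n) y" by (simp add: AE_all_countable)
  then show ?thesis
    using T_tendsto_0_lat0[OF reg(1) e0] T_tendsto_0_lat1[OF reg(2) e1]
  proof eventually_elim
    case (elim y)
    then have "(\<lambda>n. T (e0 n) y + T (e1 n) y) \<longlonglongrightarrow> 0 + 0" by (intro tendsto_add) auto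
    then show ?case using elim(1) by simp
  qed
qed

lemma T_truncation_tendsto:
  assumes reg: "regular M \<rho>0" "regular M \<rho>1"
    and f: "f \<in> X.ambient" and u: "u \<in> X.ambient" "AE x in M. 0 < u x"
  shows "AE y in N. (\<lambda>k. T (truncation u k f) y) \<longlonglongrightarrow> T f y"
proof -
  note fk = X.truncation_ambient[OF f u(1)]
  have "AE y in N. (\<lambda>k. T (\<lambda>x. f x - truncation u k f x) y) \<longlonglongrightarrow> 0"
    by (rule T_tendsto_0[OF reg X.ambient_diff[OF f fk] truncation_remainder_decreases_to_0[OF u(2)]])
  moreover have "AE y in N. \<forall>k. T (\<lambda>x. f x - truncation u k f x) y = T f y - T (truncation u k f) y"
    using T_diff[OF f fk] by (simp add: AE_all_countable)
  ultimately show ?thesis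
  proof eventually_elim
    case (elim y)
    then have "(\<lambda>k. T f y - (T f y - T (truncation u k f) y)) \<longlonglongrightarrow> T f y - 0"
      by (intro tendsto_diff tendsto_const) simp
    then show ?case by simp
  qed
qed

end

section \<open>Real interpolation\<close>

lemma Kfun_le:
  assumes "f0 \<in> borel_measurable M" "f1 \<in> borel_measurable M" "AE x in M. f x = f0 x + f1 x"
  shows "Kfun M \<rho>0 \<rho>1 t f \<le> \<rho>0 f0 + ennreal t * \<rho>1 f1"
  unfolding Kfun_def using assms by (intro INF_lower2[of "(f0, f1)"]) auto

lemma Kfun_greatest:
  assumes "\<And>f0 f1. f0 \<in> borel_measurable M \<Longrightarrow> f1 \<in> borel_measurable M \<Longrightarrow>
    AE x in M. f x = f0 x + f1 x \<Longrightarrow> z \<le> \<rho>0 f0 + ennreal t * \<rho>1 f1"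
  shows "z \<le> Kfun M \<rho>0 \<rho>1 t f"
  unfolding Kfun_def by (rule INF_greatest) (auto intro: assms)

lemma Kfun_mono: "s \<le> t \<Longrightarrow> Kfun M \<rho>0 \<rho>1 s f \<le> Kfun M \<rho>0 \<rho>1 t f"
  unfolding Kfun_def by (intro INF_mono') (auto intro!: add_left_mono mult_right_mono ennreal_leI)

lemma Kfun_borel_measurable [measurable]: "(\<lambda>t. Kfun M \<rho>0 \<rho>1 t f) \<in> borel_measurable borel"
proof (rule borel_measurableI_greater)
  fix y
  let ?S = "{t \<in> space borel. y < Kfun M \<rho>0 \<rho>1 t f}"
  have "is_interval ?S"
    unfolding is_interval_1 by (auto intro: less_le_trans[OF _ Kfun_mono])
  then show "?S \<in> sets borel"
    by (rule real_interval_borel_measurable)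
qed

lemma epow_mono: "x \<le> y \<Longrightarrow> 0 \<le> q \<Longrightarrow> epow x q \<le> epow y q"
  by (auto simp: epow_def top_unique less_top intro!: ennreal_leI powr_mono2 enn2real_mono)

lemma epow_mult:
  assumes "0 < c" "0 < q"
  shows "epow (ennreal c * x) q = ennreal (c powr q) * epow x q"
  using assms
  by (cases x)
    (auto simp: epow_def ennreal_mult[symmetric] ennreal_mult_eq_top_iff ennreal_mult_top powr_mult)

lemma epow_borel_measurable [measurable (raw)]:
  assumes [measurable]: "f \<in> borel_measurable M"
  shows "(\<lambda>x. epow (f x) q) \<in> borel_measurable M"
  unfolding epow_def by measurable

lemma real_interp_norm_eq_top:
  assumes top: "\<And>t. 0 < t \<Longrightarrow> Kfun M \<rho>0 \<rho>1 t f = \<infinity>"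
  shows "real_interp_norm M \<rho>0 \<rho>1 \<theta> p f = \<infinity>"
proof (cases "p = \<infinity>")
  case True
  have "ennreal (1 powr (- \<theta>)) * Kfun M \<rho>0 \<rho>1 1 f
      \<le> (SUP t \<in> {0<..}. ennreal (t powr (- \<theta>)) * Kfun M \<rho>0 \<rho>1 t f)"
    by (rule SUP_upper) simp
  then show ?thesis using True top[of 1] by (simp add: real_interp_norm_def top_unique)
next
  case False
  let ?I = "\<integral>\<^sup>+ t \<in> {0<..}. epow (ennreal (t powr (- \<theta>)) * Kfun M \<rho>0 \<rho>1 t f) (enn2real p)
    * ennreal (1 / t) \<partial>lborel"
  have "\<infinity> = (\<integral>\<^sup>+ t. \<infinity> * indicator {0<..1} t \<partial>(lborel :: real measure))"
    by (subst nn_integral_cmult_indicator) auto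
  also have "\<dots> \<le> ?I"
    by (intro nn_integral_mono)
      (auto simp: indicator_def top epow_def ennreal_mult_top ennreal_top_mult)
  finally show ?thesis using False by (simp add: real_interp_norm_def epow_def top_unique)
qed

lemma real_interp_norm_le:
  assumes p: "0 < p" and C: "0 < C"
    and K: "\<And>t. 0 < t \<Longrightarrow> Kfun N \<sigma>0 \<sigma>1 t g \<le> ennreal C * Kfun M \<rho>0 \<rho>1 t f"
  shows "real_interp_norm N \<sigma>0 \<sigma>1 \<theta> p g \<le> ennreal C * real_interp_norm M \<rho>0 \<rho>1 \<theta> p f"
proof -
  define kf where "kf t = ennreal (t powr (- \<theta>)) * Kfun M \<rho>0 \<rho>1 t f" for t
  define kg where "kg t = ennreal (t powr (- \<theta>)) * Kfun N \<sigma>0 \<sigma>1 t g" for t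
  have weighted: "kg t \<le> ennreal C * kf t" if "0 < t" for t
    using mult_left_mono[OF K[OF that], of "ennreal (t powr (- \<theta>))"]
    by (simp add: kf_def kg_def mult.left_commute)
  show ?thesis
  proof (cases "p = \<infinity>")
    case True
    then show ?thesis
      by (auto simp: real_interp_norm_def kf_def[symmetric] kg_def[symmetric]
          intro!: SUP_least order_trans[OF weighted] mult_left_mono SUP_upper)
  next
    case False
    define q where "q = enn2real p"
    have q: "0 < q" using p False by (simp add: q_def enn2real_positive_iff less_top)
    have [measurable]: "kf \<in> borel_measurable borel" unfolding kf_def by measurable
    have "(\<integral>\<^sup>+ t \<in> {0<..}. epow (kg t) q * ennreal (1 / t) \<partial>lborel)
        \<le> (\<integral>\<^sup>+ t. ennreal (C powr q) * (epow (kf t) q * ennreal (1 / t) * indicator {0<..} t) \<partial>lborel)"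
    proof (rule nn_integral_mono)
      fix t :: real
      have "epow (kg t) q \<le> ennreal (C powr q) * epow (kf t) q" if "0 < t"
        using epow_mono[OF weighted[OF that], of q] C q by (simp add: epow_mult)
      then show "epow (kg t) q * ennreal (1 / t) * indicator {0<..} t
          \<le> ennreal (C powr q) * (epow (kf t) q * ennreal (1 / t) * indicator {0<..} t)"
        by (cases "0 < t") (auto simp: mult.assoc[symmetric] intro!: mult_right_mono)
    qed
    also have "\<dots> = ennreal (C powr q) * (\<integral>\<^sup>+ t \<in> {0<..}. epow (kf t) q * ennreal (1 / t) \<partial>lborel)"
      by (rule nn_integral_cmult) measurable
    finally have "epow (\<integral>\<^sup>+ t \<in> {0<..}. epow (kg t) q * ennreal (1 / t) \<partial>lborel) (1 / q)
        \<le> epow (ennreal (C powr q) * (\<integral>\<^sup>+ t \<in> {0<..}. epow (kf t) q * ennreal (1 / t) \<partial>lborel)) (1 / q)"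
      using q by (intro epow_mono) auto
    then show ?thesis
      using False C q by (simp add: epow_mult powr_powr real_interp_norm_def kf_def kg_def q_def)
  qed
qed

lemma (in lattice_couple) Kfun_finite_imp_ambient:
  assumes f: "f \<in> borel_measurable M" and t: "0 < t" and fin: "Kfun M \<rho>0 \<rho>1 t f < \<infinity>"
  shows "f \<in> ambient"
proof -
  obtain f0 f1 where "f0 \<in> borel_measurable M" "f1 \<in> borel_measurable M"
    "AE x in M. f x = f0 x + f1 x" "\<rho>0 f0 + ennreal t * \<rho>1 f1 < \<infinity>"
    using fin unfolding Kfun_def Inf_less_iff by auto
  moreover from this have "\<rho>0 f0 < \<infinity>" "\<rho>1 f1 < \<infinity>"
    using t by (auto simp: ennreal_mult_less_top)
  ultimately show ?thesis by (intro sum_spaceI[OF f]) (auto simp: lat_def)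
qed

lemma (in lattice_couple) real_interp_subset_ambient: "real_interp M \<rho>0 \<rho>1 \<theta> p \<subseteq> ambient"
proof
  fix f assume "f \<in> real_interp M \<rho>0 \<rho>1 \<theta> p"
  then have f: "f \<in> borel_measurable M" "real_interp_norm M \<rho>0 \<rho>1 \<theta> p f < \<infinity>"
    by (auto simp: real_interp_def lat_def)
  then obtain t where "0 < t" "Kfun M \<rho>0 \<rho>1 t f \<noteq> \<infinity>"
    using real_interp_norm_eq_top by (metis less_irrefl)
  then show "f \<in> ambient"
    by (intro Kfun_finite_imp_ambient f(1)) (auto simp: less_top)
qed

context positive_operator
begin

lemma Kfun_T_le:
  obtains C where "0 < C"
    "\<And>t f. 0 < t \<Longrightarrow> f \<in> X.ambient \<Longrightarrow> Kfun N \<sigma>0 \<sigma>1 t (T f) \<le> ennreal C * Kfun M \<rho>0 \<rho>1 t f"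
proof -
  obtain C where C: "0 < C" "\<And>f. f \<in> lat M \<rho>0 \<Longrightarrow> \<sigma>0 (T f) \<le> ennreal C * \<rho>0 f"
    "\<And>f. f \<in> lat M \<rho>1 \<Longrightarrow> \<sigma>1 (T f) \<le> ennreal C * \<rho>1 f"
    using T_bound by blast
  have decomposition_bound: "Kfun N \<sigma>0 \<sigma>1 t (T f) \<le> ennreal C * (\<rho>0 f0 + ennreal t * \<rho>1 f1)"
    if t: "0 < t" and f: "f \<in> X.ambient" and f0: "f0 \<in> borel_measurable M"
      and f1: "f1 \<in> borel_measurable M" and eq: "AE x in M. f x = f0 x + f1 x" for t f f0 f1
  proof (cases "\<rho>0 f0 < \<infinity> \<and> \<rho>1 f1 < \<infinity>")
    case True
    then have lat: "f0 \<in> lat M \<rho>0" "f1 \<in> lat M \<rho>1" using f0 f1 by (auto simp: lat_def)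
    then have in_ambient: "f0 \<in> X.ambient" "f1 \<in> X.ambient"
      by (auto intro: X.lat0_ambient X.lat1_ambient)
    have "AE y in N. T f y = T f0 y + T f1 y"
      using T_cong[OF f X.ambient_add[OF in_ambient] eq] T_add[OF in_ambient] by eventually_elim simp
    then have "Kfun N \<sigma>0 \<sigma>1 t (T f) \<le> \<sigma>0 (T f0) + ennreal t * \<sigma>1 (T f1)"
      by (intro Kfun_le T_measurable in_ambient)
    also have "\<dots> \<le> ennreal C * \<rho>0 f0 + ennreal t * (ennreal C * \<rho>1 f1)"
      by (intro add_mono mult_left_mono C lat) simp
    also have "\<dots> = ennreal C * (\<rho>0 f0 + ennreal t * \<rho>1 f1)"
      by (simp add: distrib_left mult.left_commute)
    finally show ?thesis .
  next
    case False
    then have "\<rho>0 f0 + ennreal t * \<rho>1 f1 = \<infinity>"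
      using t by (auto simp: less_top[symmetric] ennreal_mult_eq_top_iff)
    then show ?thesis using C(1) by (simp only:) (simp add: ennreal_mult_top)
  qed
  show ?thesis
  proof (rule that[OF C(1)])
    fix t :: real and f assume "0 < t" "f \<in> X.ambient"
    then have "ennreal (inverse C) * Kfun N \<sigma>0 \<sigma>1 t (T f) \<le> Kfun M \<rho>0 \<rho>1 t f"
      by (intro Kfun_greatest) (simp add: ennreal_inverse_mult_le_iff[OF C(1)] decomposition_bound)
    then show "Kfun N \<sigma>0 \<sigma>1 t (T f) \<le> ennreal C * Kfun M \<rho>0 \<rho>1 t f"
      by (simp add: ennreal_inverse_mult_le_iff[OF C(1)])
  qed
qed

lemma T_real_interp:
  assumes f: "f \<in> real_interp M \<rho>0 \<rho>1 \<theta> p" and p: "0 < p"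
  shows "T f \<in> real_interp N \<sigma>0 \<sigma>1 \<theta> p"
proof -
  have f_ambient: "f \<in> X.ambient" using X.real_interp_subset_ambient f by blast
  obtain C where "0 < C"
    "\<And>t f. 0 < t \<Longrightarrow> f \<in> X.ambient \<Longrightarrow> Kfun N \<sigma>0 \<sigma>1 t (T f) \<le> ennreal C * Kfun M \<rho>0 \<rho>1 t f"
    using Kfun_T_le by blast
  then have "real_interp_norm N \<sigma>0 \<sigma>1 \<theta> p (T f) \<le> ennreal C * real_interp_norm M \<rho>0 \<rho>1 \<theta> p f"
    using p f_ambient by (intro real_interp_norm_le)
  also have "\<dots> < \<infinity>" using f by (simp add: real_interp_def lat_def ennreal_mult_less_top)
  finally show ?thesis using T_measurable[OF f_ambient] by (simp add: real_interp_def lat_def)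
qed

end

section \<open>Reflection of positivity\<close>

locale calderon_isomorphism = positive_operator +
  fixes s :: real
  assumes s: "0 < s" "s < 1"
    and iso: "order_iso M N T (calderon M \<rho>0 \<rho>1 s) (calderon N \<sigma>0 \<sigma>1 s)"
    and fatou_dom: "fatou M \<rho>0" "fatou M \<rho>1"
    and regular_dom: "regular M \<rho>0" "regular M \<rho>1"
    and regular_cod: "regular N \<sigma>0" "regular N \<sigma>1"
begin

lemma s_unit_interval: "0 \<le> s" "s \<le> 1"
  using s by simp_all

lemma T_surj_calderon: "g \<in> Y.calderon_space s \<Longrightarrow> \<exists>f\<in>X.calderon_space s. AE y in N. T f y = g y"
  and T_reflects_nonneg_calderon:
    "f \<in> X.calderon_space s \<Longrightarrow> AE y in N. 0 \<le> T f y \<Longrightarrow> AE x in M. 0 \<le> f x"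
  using iso unfolding order_iso_def by (blast+)

lemma calderon_ambient: "f \<in> X.calderon_space s \<Longrightarrow> f \<in> X.ambient"
  using X.calderon_subset_ambient[OF s_unit_interval] by blast

lemma T_reflects_le_calderon:
  assumes f: "f \<in> X.calderon_space s" and g: "g \<in> X.calderon_space s"
    and Tf_le_Tg: "AE y in N. T f y \<le> T g y"
  shows "AE x in M. f x \<le> g x"
proof -
  have "(\<lambda>x. 1 * g x + -1 * f x) \<in> X.calderon_space s"
    by (rule X.calderon_lincomb[OF g f s_unit_interval])
  moreover have "AE y in N. 0 \<le> T (\<lambda>x. 1 * g x + -1 * f x) y"
    using T_lincomb[OF calderon_ambient[OF g] calderon_ambient[OF f], of 1 "-1"] Tf_le_Tg
    by eventually_elim simp
  ultimately have "AE x in M. 0 \<le> 1 * g x + -1 * f x" by (rule T_reflects_nonneg_calderon)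
  then show ?thesis by eventually_elim simp
qed

lemma T_min_calderon:
  assumes f: "f \<in> X.calderon_space s" "AE x in M. 0 \<le> f x"
    and g: "g \<in> X.calderon_space s" "AE x in M. 0 \<le> g x"
  shows "AE y in N. T (\<lambda>x. min (f x) (g x)) y = min (T f y) (T g y)"
proof -
  note f_ambient = calderon_ambient[OF f(1)] and g_ambient = calderon_ambient[OF g(1)]
  note [measurable] = T_measurable[OF f_ambient] T_measurable[OF g_ambient]
    X.calderon_measurable[OF f(1)] X.calderon_measurable[OF g(1)]
  have min_fg: "(\<lambda>x. min (f x) (g x)) \<in> X.calderon_space s"
    by (rule X.calderon_solid[OF _ f(1)]) (measurable, use f(2) g(2) in eventually_elim, simp)
  have "(\<lambda>y. min (T f y) (T g y)) \<in> Y.calderon_space s"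
    by (rule Y.calderon_solid[OF _ T_calderon[OF f(1) s]])
      (measurable, use T_nonneg[OF f_ambient f(2)] T_nonneg[OF g_ambient g(2)]
        in eventually_elim, simp)
  then obtain r where r: "r \<in> X.calderon_space s" "AE y in N. T r y = min (T f y) (T g y)"
    using T_surj_calderon by blast
  have "AE x in M. r x \<le> f x"
    by (rule T_reflects_le_calderon[OF r(1) f(1)]) (use r(2) in eventually_elim, simp)
  moreover have "AE x in M. r x \<le> g x"
    by (rule T_reflects_le_calderon[OF r(1) g(1)]) (use r(2) in eventually_elim, simp)
  ultimately have "AE x in M. r x \<le> min (f x) (g x)" by eventually_elim simp
  note lower = T_mono[OF calderon_ambient[OF r(1)] calderon_ambient[OF min_fg] this]
  have "AE y in N. T (\<lambda>x. min (f x) (g x)) y \<le> T f y" "AE y in N. T (\<lambda>x. min (f x) (g x)) y \<le> T g y"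
    by (intro T_mono calderon_ambient[OF min_fg] f_ambient g_ambient; simp)+
  then show ?thesis using lower r(2) by eventually_elim simp
qed

lemma T_disjoint:
  assumes p: "p \<in> X.calderon_space s" "AE x in M. 0 \<le> p x"
    and g: "g \<in> X.ambient" "AE x in M. 0 \<le> g x" and disj: "AE x in M. min (p x) (g x) = 0"
  shows "AE y in N. min (T p y) (T g y) = 0"
proof -
  obtain u where u: "u \<in> lat M \<rho>0" "u \<in> lat M \<rho>1" "\<And>x. 0 \<le> u x" "AE x in M. 0 < u x"
    by (rule X.ex_positive_common) blast
  let ?g = "\<lambda>k. truncation u k g"
  have gk: "?g k \<in> X.calderon_space s" "AE x in M. 0 \<le> ?g k x" for k
    using g by (auto intro!: X.truncation_calderon u(1-3) X.ambient_measurable truncation_nonneg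
        elim!: eventually_mono)
  have "AE y in N. min (T p y) (T (?g k) y) = 0" for k
  proof -
    have min_zero: "AE x in M. min (p x) (?g k x) = 0"
      using disj p(2) gk(2)[of k]
    proof eventually_elim
      case (elim x)
      then show ?case using truncation_le[of u k g x] by (auto simp: min_def split: if_splits)
    qed
    have "(\<lambda>x. min (p x) (?g k x)) \<in> X.ambient"
    proof (rule X.ambient_solid[OF _ calderon_ambient[OF p(1)]])
      show "AE x in M. \<bar>min (p x) (?g k x)\<bar> \<le> \<bar>p x\<bar>" using min_zero by eventually_elim simp
    qed (use p(1) gk(1) in measurable)
    from T_eq_0[OF this min_zero] T_min_calderon[OF p gk[of k]] show ?thesis by eventually_elim simp
  qed
  then have "AE y in N. \<forall>k. min (T p y) (T (?g k) y) = 0" by (simp add: AE_all_countable)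
  then show ?thesis
    using T_truncation_tendsto[OF regular_dom g(1) X.lat0_ambient[OF u(1)] u(4)]
  proof eventually_elim
    case (elim y)
    have "(\<lambda>k. min (T p y) (T (?g k) y)) \<longlonglongrightarrow> min (T p y) (T g y)"
      by (intro tendsto_min tendsto_const elim(2))
    then show ?case using elim(1) by (simp add: LIMSEQ_const_iff)
  qed
qed

text \<open>If \<open>T f \<ge> 0\<close>, then \<open>T p \<le> T f\<^sup>- \<le> T f\<^sup>+\<close> for every \<open>p \<le> f\<^sup>-\<close> in the Calderon product, while
  \<open>T p\<close> and \<open>T f\<^sup>+\<close> are disjoint; so \<open>T p = 0\<close>.\<close>
lemma T_reflects_nonneg:
  assumes f: "f \<in> X.ambient" and Tf: "AE y in N. 0 \<le> T f y"
  shows "AE x in M. 0 \<le> f x"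
proof -
  obtain u where u: "u \<in> lat M \<rho>0" "u \<in> lat M \<rho>1" "\<And>x. 0 \<le> u x" "AE x in M. 0 < u x"
    by (rule X.ex_positive_common) blast
  note [measurable] = X.ambient_measurable[OF f]
  define neg where "neg = (\<lambda>x. max 0 (- f x))"
  define pos where "pos = (\<lambda>x. max 0 (f x))"
  define p where "p = truncation u 1 neg"
  have neg: "neg \<in> X.ambient" by (rule X.ambient_solid[OF _ f]) (auto simp: neg_def)
  have pos: "pos \<in> X.ambient" by (rule X.ambient_solid[OF _ f]) (auto simp: pos_def)
  have p: "p \<in> X.calderon_space s"
    unfolding p_def
    by (intro X.truncation_calderon u(1-3) X.ambient_measurable[OF neg]) (simp add: neg_def)
  have p_nonneg: "0 \<le> p x" for x using u(3) by (simp add: p_def neg_def truncation_nonneg)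
  have p_le: "p x \<le> neg x" for x by (simp add: p_def truncation_le)
  then have "AE y in N. T p y \<le> T neg y" by (intro T_mono calderon_ambient[OF p] neg) simp
  moreover have "AE y in N. T f y = T pos y - T neg y"
    using T_diff[OF pos neg] T_cong[OF f X.ambient_diff[OF pos neg]] by (auto simp: pos_def neg_def)
  moreover have "AE y in N. min (T p y) (T pos y) = 0"
  proof (rule T_disjoint[OF p _ pos])
    have "min (p x) (pos x) = 0" for x
      using p_nonneg[of x] p_le[of x] by (auto simp: neg_def pos_def min_def max_def split: if_splits)
    then show "AE x in M. min (p x) (pos x) = 0" by simp
  qed (simp_all add: p_nonneg pos_def)
  ultimately have "AE y in N. T p y \<le> T (\<lambda>x. 0) y"
    using Tf T_eq_0[OF X.lat0_ambient[OF X.L0.zero_lat]] by auto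
  then have "AE x in M. p x \<le> 0"
    by (rule T_reflects_le_calderon[OF p X.lat_Int_calderon[OF X.L0.zero_lat X.L1.zero_lat]])
  then show ?thesis
    using u(4)
    by eventually_elim (auto simp: p_def truncation_def neg_def min_def max_def split: if_splits)
qed

lemma T_reflects_le:
  assumes f: "f \<in> X.ambient" and g: "g \<in> X.ambient" and Tf_le_Tg: "AE y in N. T f y \<le> T g y"
  shows "AE x in M. f x \<le> g x"
proof -
  have "AE x in M. 0 \<le> g x - f x"
    by (rule T_reflects_nonneg[OF X.ambient_diff[OF g f]])
      (use Tf_le_Tg T_diff[OF g f] in \<open>eventually_elim, simp\<close>)
  then show ?thesis by eventually_elim simp
qed

lemma T_injective:
  assumes f: "f \<in> X.ambient" and g: "g \<in> X.ambient" and eq: "AE y in N. T f y = T g y"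
  shows "AE x in M. f x = g x"
proof -
  have "AE x in M. f x \<le> g x"
    by (rule T_reflects_le[OF f g]) (use eq in eventually_elim, simp)
  moreover have "AE x in M. g x \<le> f x"
    by (rule T_reflects_le[OF g f]) (use eq in eventually_elim, simp)
  ultimately show ?thesis by eventually_elim simp
qed

section \<open>Lower bounds at the endpoints\<close>

lemma calderon_bound_of_T_le:
  assumes q: "q \<in> Y.calderon_space s"
  obtains l where "0 < l" "\<And>c p. p \<in> X.ambient \<Longrightarrow> AE x in M. 0 \<le> p x \<Longrightarrow> 0 \<le> c \<Longrightarrow>
    AE y in N. T p y \<le> c * q y \<Longrightarrow> X.calderon_bound s p (c * l)"
proof -
  obtain r where r: "r \<in> X.calderon_space s" "AE y in N. T r y = q y"
    using T_surj_calderon[OF q] by blast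
  note r_ambient = calderon_ambient[OF r(1)]
  obtain l where l: "0 < l" "X.calderon_bound s r l" using r(1) X.mem_calderon_iff by blast
  show ?thesis
  proof (rule that[OF l(1)])
    fix c p assume p: "p \<in> X.ambient" "AE x in M. 0 \<le> p x" and c: "0 \<le> c"
      and Tp: "AE y in N. T p y \<le> c * q y"
    have "AE x in M. p x \<le> c * r x"
      by (rule T_reflects_le[OF p(1) X.ambient_scale[OF r_ambient]])
        (use Tp r(2) T_scale[OF r_ambient, of c] in \<open>eventually_elim, simp\<close>)
    then have "AE x in M. \<bar>p x\<bar> \<le> c * \<bar>r x\<bar>"
      using p(2)
    proof eventually_elim
      case (elim x)
      note elim(1)
      also have "c * r x \<le> c * \<bar>r x\<bar>" using c by (intro mult_left_mono) auto
      finally show ?case using elim(2) by simp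
    qed
    then show "X.calderon_bound s p (c * l)"
      by (rule X.calderon_bound_mono[OF l(2)]) (simp_all add: c)
  qed
qed

text \<open>If no constant worked, then some \<open>q\<close> in the Calderon product of the \<open>Y\<^sub>j\<close> would satisfy
  \<open>T p\<^sub>n \<le> 2\<^sup>n q\<close> for counterexamples \<open>p\<^sub>n\<close> to the constants \<open>4\<^sup>n\<close>, and the preimage of \<open>q\<close> would
  dominate \<open>p\<^sub>n / 2\<^sup>n\<close>.\<close>
lemma calderon_bound_unit_reflect:
  obtains C where "0 < C" "\<And>p. p \<in> X.ambient \<Longrightarrow> AE x in M. 0 \<le> p x \<Longrightarrow>
    Y.calderon_bound s (T p) 1 \<Longrightarrow> X.calderon_bound s p C"
proof -
  define unit_image where "unit_image p \<longleftrightarrow>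
    p \<in> X.ambient \<and> (AE x in M. 0 \<le> p x) \<and> Y.calderon_bound s (T p) 1" for p
  have "\<exists>C>0. \<forall>p. unit_image p \<longrightarrow> X.calderon_bound s p C"
  proof (rule ccontr)
    assume "\<not> ?thesis"
    then have "\<forall>n::nat. \<exists>p. unit_image p \<and> \<not> X.calderon_bound s p (4 ^ n)"
      by (meson zero_less_numeral zero_less_power)
    then obtain p where image: "\<And>n::nat. unit_image (p n)"
      and unbounded: "\<And>n. \<not> X.calderon_bound s (p n) (4 ^ n)"
      by metis
    have p: "\<And>n. p n \<in> X.ambient" "\<And>n. AE x in M. 0 \<le> p n x"
      and Tp: "\<And>n. Y.calderon_bound s (T (p n)) 1" using image unfolding unit_image_def by blast+
    obtain q where q: "q \<in> Y.calderon_space s" "\<And>n. AE y in N. \<bar>T (p n) y\<bar> \<le> 2 ^ n * q y"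
      by (rule Y.calderon_common_bound[of s "\<lambda>n. T (p n)", OF Tp s_unit_interval]) blast
    obtain l where l: "0 < l" "\<And>c p. p \<in> X.ambient \<Longrightarrow> AE x in M. 0 \<le> p x \<Longrightarrow> 0 \<le> c \<Longrightarrow>
        AE y in N. T p y \<le> c * q y \<Longrightarrow> X.calderon_bound s p (c * l)"
      using calderon_bound_of_T_le[OF q(1)] by blast
    obtain n where n: "l \<le> 2 ^ n" using real_arch_pow[of 2 l] by (auto intro: less_imp_le)
    have bound: "X.calderon_bound s (p n) (2 ^ n * l)"
      by (rule l(2)[OF p]) (simp, use q(2)[of n] in eventually_elim, simp)
    have power_bound: "2 ^ n * l \<le> 4 ^ n"
    proof -
      have "2 ^ n * l \<le> 2 ^ n * 2 ^ n" using n by simp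
      then show ?thesis by (simp add: power_mult_distrib[symmetric])
    qed
    have "X.calderon_bound s (p n) (4 ^ n)"
      by (rule X.calderon_bound_mono[OF bound, of _ 1]) (simp_all add: power_bound)
    then show False using unbounded by blast
  qed
  then show ?thesis using that unfolding unit_image_def by blast
qed

lemma calderon_bound_reflect:
  obtains C where "0 < C" "\<And>p l. p \<in> X.ambient \<Longrightarrow> AE x in M. 0 \<le> p x \<Longrightarrow> 0 < l \<Longrightarrow>
    Y.calderon_bound s (T p) l \<Longrightarrow> X.calderon_bound s p (C * l)"
proof -
  obtain C where C: "0 < C" "\<And>p. p \<in> X.ambient \<Longrightarrow> AE x in M. 0 \<le> p x \<Longrightarrow>
      Y.calderon_bound s (T p) 1 \<Longrightarrow> X.calderon_bound s p C"
    using calderon_bound_unit_reflect by blast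
  show ?thesis
  proof (rule that[OF C(1)])
    fix p l assume p: "p \<in> X.ambient" "AE x in M. 0 \<le> p x"
      and l: "0 < l" "Y.calderon_bound s (T p) l"
    have "Y.calderon_bound s (T (\<lambda>x. inverse l * p x)) 1"
      by (rule Y.calderon_bound_mono[OF l(2), where c = "inverse l"])
        (use T_scale[OF p(1), of "inverse l"] l(1) in \<open>auto simp: abs_mult elim!: eventually_mono\<close>)
    moreover have "AE x in M. 0 \<le> inverse l * p x"
      using p(2) by eventually_elim (simp add: l(1) less_imp_le)
    ultimately have "X.calderon_bound s (\<lambda>x. inverse l * p x) C"
      by (intro C(2) X.ambient_scale p(1))
    then show "X.calderon_bound s p (C * l)"
      by (rule X.calderon_bound_mono[where c = l])
        (use l(1) in \<open>auto simp: abs_mult mult.assoc[symmetric]\<close>)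
  qed
qed

lemma T_geom_mean_calderon_bound:
  obtains D where "0 < D" "\<And>f h. f \<in> X.ambient \<Longrightarrow> AE x in M. 0 \<le> f x \<Longrightarrow> T f \<in> unit_ball N \<sigma>0 \<Longrightarrow>
    h \<in> unit_ball M \<rho>1 \<Longrightarrow> Y.calderon_bound s (T (\<lambda>x. geom_mean s (f x) (h x))) D"
proof -
  obtain D where D: "0 < D" "\<And>f. f \<in> lat M \<rho>1 \<Longrightarrow> \<sigma>1 (T f) \<le> ennreal D * \<rho>1 f"
    using T_bound1 by blast
  show ?thesis
  proof (rule that[of "D powr s"])
    fix f h assume f: "f \<in> X.ambient" "AE x in M. 0 \<le> f x" and Tf: "T f \<in> unit_ball N \<sigma>0"
      and h: "h \<in> unit_ball M \<rho>1"
    note h_lat = X.L1.unit_ball_lat[OF h]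
    note h_ambient = X.lat1_ambient[OF h_lat]
    let ?g = "\<lambda>x. geom_mean s (f x) (h x)" and ?Th = "T (\<lambda>x. \<bar>h x\<bar>)"
    have "\<sigma>1 ?Th \<le> ennreal D * \<rho>1 (\<lambda>x. \<bar>h x\<bar>)" by (intro D X.L1.lat_abs h_lat)
    also have "\<dots> \<le> ennreal D * 1"
      using X.L1.unit_ball_norm[OF h] X.L1.unit_ball_measurable[OF h]
      by (intro mult_left_mono) (simp_all add: X.L1.norm_abs)
    finally have "(\<lambda>y. inverse D * ?Th y) \<in> unit_ball N \<sigma>1"
      using D(1) T_measurable[OF X.ambient_abs[OF h_ambient]]
      by (simp add: Y.L1.scaled_in_unit_ball_iff)
    moreover have unscale: "D powr s * geom_mean s a (inverse D * b) = geom_mean s a b" for a b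
      using D(1) by (simp add: geom_mean_def abs_mult powr_mult inverse_powr)
    have "AE y in N. \<bar>T ?g y\<bar> \<le> D powr s * geom_mean s (T f y) (inverse D * ?Th y)"
    proof -
      have "AE y in N. T (\<lambda>x. \<bar>f x\<bar>) y = T f y"
        by (rule T_cong[OF X.ambient_abs[OF f(1)] f(1)]) (use f(2) in eventually_elim, simp)
      moreover have "AE y in N. 0 \<le> T ?g y"
        by (rule T_nonneg[OF X.ambient_geom_mean[OF f(1) h_ambient s_unit_interval]]) simp
      ultimately show ?thesis
        using T_geom_mean_le[OF f(1) h_ambient s] by eventually_elim (simp add: unscale)
    qed
    ultimately show "Y.calderon_bound s (T ?g) (D powr s)" by (rule Y.calderon_boundI[OF Tf])
  qed (use D(1) in simp)
qed

lemma norm0_bound_unit_ball: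
  obtains K where "0 < K"
    "\<And>f. f \<in> X.ambient \<Longrightarrow> AE x in M. 0 \<le> f x \<Longrightarrow> T f \<in> unit_ball N \<sigma>0 \<Longrightarrow> \<rho>0 f \<le> ennreal K"
proof -
  obtain C where C: "0 < C" "\<And>p l. p \<in> X.ambient \<Longrightarrow> AE x in M. 0 \<le> p x \<Longrightarrow> 0 < l \<Longrightarrow>
      Y.calderon_bound s (T p) l \<Longrightarrow> X.calderon_bound s p (C * l)"
    using calderon_bound_reflect by blast
  obtain D where D: "0 < D" "\<And>f h. f \<in> X.ambient \<Longrightarrow> AE x in M. 0 \<le> f x \<Longrightarrow> T f \<in> unit_ball N \<sigma>0 \<Longrightarrow>
      h \<in> unit_ball M \<rho>1 \<Longrightarrow> Y.calderon_bound s (T (\<lambda>x. geom_mean s (f x) (h x))) D"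
    using T_geom_mean_calderon_bound by blast
  show ?thesis
  proof (rule that[of "(C * D * 4 powr s) powr (1 / (1 - s))"])
    fix f assume f: "f \<in> X.ambient" "AE x in M. 0 \<le> f x" "T f \<in> unit_ball N \<sigma>0"
    show "\<rho>0 f \<le> ennreal ((C * D * 4 powr s) powr (1 / (1 - s)))"
    proof (rule X.norm_bound_of_factorization[OF fatou_dom(1) X.ambient_measurable[OF f(1)] _ s])
      fix h assume h: "h \<in> unit_ball M \<rho>1"
      then have "h \<in> X.ambient" by (intro X.lat1_ambient X.L1.unit_ball_lat)
      then show "X.calderon_bound s (\<lambda>x. geom_mean s (f x) (h x)) (C * D)"
        by (intro C(2) X.ambient_geom_mean f s_unit_interval D h) simp_all
    qed (use C(1) D(1) in simp)
  qed (use C(1) D(1) in simp)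
qed

lemma norm0_bound_nonneg:
  obtains K where "0 < K"
    "\<And>f. f \<in> X.ambient \<Longrightarrow> AE x in M. 0 \<le> f x \<Longrightarrow> \<rho>0 f \<le> ennreal K * \<sigma>0 (T f)"
proof -
  obtain K where K: "0 < K"
    "\<And>f. f \<in> X.ambient \<Longrightarrow> AE x in M. 0 \<le> f x \<Longrightarrow> T f \<in> unit_ball N \<sigma>0 \<Longrightarrow> \<rho>0 f \<le> ennreal K"
    using norm0_bound_unit_ball by blast
  show ?thesis
  proof (rule that[OF K(1)], rule le_ennreal_mult_of_real_bounds[OF K(1)])
    fix f and m :: real
    assume f: "f \<in> X.ambient" "AE x in M. 0 \<le> f x" and m: "0 < m" "\<sigma>0 (T f) \<le> ennreal m"
    note f_measurable = X.ambient_measurable[OF f(1)] and Tf_measurable = T_measurable[OF f(1)]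
    note scaled = X.ambient_scale[OF f(1), of "inverse m"]
    have "\<sigma>0 (T (\<lambda>x. inverse m * f x)) = \<sigma>0 (\<lambda>y. inverse m * T f y)"
      using Tf_measurable
      by (intro Y.L0.norm_cong T_measurable[OF scaled] T_scale[OF f(1)]) measurable
    also have "\<dots> \<le> 1"
      using m Tf_measurable by (intro Y.L0.unit_ball_norm) (simp add: Y.L0.scaled_in_unit_ball_iff)
    finally have "T (\<lambda>x. inverse m * f x) \<in> unit_ball N \<sigma>0"
      using T_measurable[OF scaled] by (simp add: unit_ball_def)
    moreover have "AE x in M. 0 \<le> inverse m * f x"
      using f(2) by eventually_elim (simp add: m(1) less_imp_le)
    ultimately have "\<rho>0 (\<lambda>x. inverse m * f x) \<le> ennreal K" by (intro K scaled)
    then have "ennreal (inverse m) * \<rho>0 f \<le> ennreal K"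
      using m(1) f_measurable by (simp add: X.L0.norm_scale)
    then have "\<rho>0 f \<le> ennreal m * ennreal K" by (simp only: ennreal_inverse_mult_le_iff[OF m(1)])
    then show "\<rho>0 f \<le> ennreal (K * m)" using m(1) K(1) by (simp add: ennreal_mult mult.commute)
  qed
qed

lemma norm0_le_of_T_le:
  obtains K where "\<And>f g. f \<in> X.ambient \<Longrightarrow> g \<in> borel_measurable N \<Longrightarrow> AE y in N. 0 \<le> T f y \<Longrightarrow>
    AE y in N. T f y \<le> g y \<Longrightarrow> \<rho>0 f \<le> ennreal K * \<sigma>0 g"
proof -
  obtain K where K: "\<And>f. f \<in> X.ambient \<Longrightarrow> AE x in M. 0 \<le> f x \<Longrightarrow> \<rho>0 f \<le> ennreal K * \<sigma>0 (T f)"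
    using norm0_bound_nonneg by blast
  show ?thesis
  proof (rule that)
    fix f g assume f: "f \<in> X.ambient" and g: "g \<in> borel_measurable N"
      and T: "AE y in N. 0 \<le> T f y" "AE y in N. T f y \<le> g y"
    have "\<rho>0 f \<le> ennreal K * \<sigma>0 (T f)" by (rule K[OF f T_reflects_nonneg[OF f T(1)]])
    also have "\<sigma>0 (T f) \<le> \<sigma>0 g"
      by (rule Y.L0.norm_mono[OF T_measurable[OF f] g]) (use T in eventually_elim, simp)
    finally show "\<rho>0 f \<le> ennreal K * \<sigma>0 g" by (simp add: mult_left_mono)
  qed
qed

section \<open>The inverse operator\<close>

lemma T_surj_lat_Int_nonneg:
  assumes g: "g \<in> lat N \<sigma>0" "g \<in> lat N \<sigma>1" "AE y in N. 0 \<le> g y"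
  obtains f where "f \<in> lat M \<rho>0" "AE y in N. T f y = g y"
proof -
  obtain f where f: "f \<in> X.calderon_space s" "AE y in N. T f y = g y"
    using T_surj_calderon[OF Y.lat_Int_calderon[OF g(1,2)]] by blast
  obtain K where K: "\<And>f g. f \<in> X.ambient \<Longrightarrow> g \<in> borel_measurable N \<Longrightarrow> AE y in N. 0 \<le> T f y \<Longrightarrow>
      AE y in N. T f y \<le> g y \<Longrightarrow> \<rho>0 f \<le> ennreal K * \<sigma>0 g"
    using norm0_le_of_T_le by blast
  have "AE y in N. 0 \<le> T f y" "AE y in N. T f y \<le> g y"
    using f(2) g(3) by (eventually_elim, simp)+
  then have "\<rho>0 f \<le> ennreal K * \<sigma>0 g"
    by (rule K[OF calderon_ambient[OF f(1)] Y.L0.lat_measurable[OF g(1)]])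
  also have "\<dots> < \<infinity>" using Y.L0.lat_finite[OF g(1)] by (simp add: ennreal_mult_less_top)
  finally have "f \<in> lat M \<rho>0" using X.calderon_measurable[OF f(1)] by (simp add: lat_def)
  then show ?thesis using f(2) that by blast
qed

lemma T_surj_lat0_nonneg:
  assumes g: "g \<in> lat N \<sigma>0" "AE y in N. 0 \<le> g y"
  obtains f where "f \<in> lat M \<rho>0" "AE y in N. T f y = g y"
proof -
  obtain v where v: "v \<in> lat N \<sigma>0" "v \<in> lat N \<sigma>1" "\<And>y. 0 \<le> v y" "AE y in N. 0 < v y"
    by (rule Y.ex_positive_common) blast
  note g_measurable = Y.L0.lat_measurable[OF g(1)]
  let ?g = "\<lambda>n. truncation v n g"
  have g0: "?g n \<in> lat N \<sigma>0" and g1: "?g n \<in> lat N \<sigma>1" for n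
    by (rule Y.L0.lat_truncation[OF g_measurable g(2) v(1,3)]
        Y.L1.lat_truncation[OF g_measurable g(2) v(2,3)])+
  have "AE y in N. 0 \<le> ?g n y" for n
    using g(2) by eventually_elim (rule truncation_nonneg[of v, OF v(3)])
  then have "\<forall>n. \<exists>f\<in>lat M \<rho>0. AE y in N. T f y = ?g n y"
    using T_surj_lat_Int_nonneg[OF g0 g1] by metis
  then obtain f where f: "\<And>n. f n \<in> lat M \<rho>0" "\<And>n. AE y in N. T (f n) y = ?g n y" by metis
  note f_ambient = X.lat0_ambient[OF f(1)]
  let ?e = "\<lambda>n. \<sigma>0 (\<lambda>y. g y - ?g n y)"
  have e: "?e \<longlonglongrightarrow> 0"
    by (intro Y.L0.norm_tendsto_0_of_decreasing[OF regular_cod(1)] Y.L0.lat_diff g(1) g0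
        truncation_remainder_decreases_to_0 v(4))
  obtain K where K: "\<And>f g. f \<in> X.ambient \<Longrightarrow> g \<in> borel_measurable N \<Longrightarrow> AE y in N. 0 \<le> T f y \<Longrightarrow>
      AE y in N. T f y \<le> g y \<Longrightarrow> \<rho>0 f \<le> ennreal K * \<sigma>0 g"
    using norm0_le_of_T_le by blast
  have incr: "\<rho>0 (\<lambda>x. f (k + n) x - f k x) \<le> ennreal K * ?e k" for k n
  proof (rule K[OF X.ambient_diff[OF f_ambient[of "k + n"] f_ambient[of k]]])
    have T: "AE y in N. T (\<lambda>x. f (k + n) x - f k x) y = ?g (k + n) y - ?g k y"
      using T_diff[OF f_ambient[of "k + n"] f_ambient[of k]] f(2)[of "k + n"] f(2)[of k]
      by eventually_elim simp
    have "?g k y \<le> ?g (k + n) y" for y by (intro truncation_mono v(3)) simp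
    then show "AE y in N. 0 \<le> T (\<lambda>x. f (k + n) x - f k x) y"
      using T by (auto elim!: eventually_mono)
    show "AE y in N. T (\<lambda>x. f (k + n) x - f k x) y \<le> g y - ?g k y"
      using T by eventually_elim (simp add: truncation_le)
  qed (use g_measurable Y.L0.lat_measurable[OF g0] in measurable)
  have "\<sigma>0 (\<lambda>y. T (f n) y - g y) = ?e n" for n
    by (rule trans[OF Y.L0.norm_cong Y.L0.norm_minus_commute])
      (use T_measurable[OF f_ambient] g_measurable Y.L0.lat_measurable[OF g0] f(2)[of n]
        in \<open>auto elim!: eventually_mono\<close>)
  then have "Y.L0.converges (\<lambda>n. T (f n)) g" using e by (simp add: Y.L0.converges_def)
  moreover have "(\<lambda>k. ennreal K * ?e k) \<longlonglongrightarrow> 0"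
    using ennreal_tendsto_cmult[OF _ e, of "ennreal K"] by simp
  ultimately show ?thesis by (rule T_preimage_of_limit0[OF f(1) g_measurable _ incr _ that])
qed

lemma T_surj_lat0:
  assumes g: "g \<in> lat N \<sigma>0"
  obtains f where "f \<in> lat M \<rho>0" "AE y in N. T f y = g y"
proof -
  note [measurable] = Y.L0.lat_measurable[OF g]
  have "(\<lambda>y. max 0 (g y)) \<in> lat N \<sigma>0" by (rule Y.L0.lat_solid[OF _ g]) auto
  then obtain f1 where f1: "f1 \<in> lat M \<rho>0" "AE y in N. T f1 y = max 0 (g y)"
    by (rule T_surj_lat0_nonneg) auto
  have "(\<lambda>y. max 0 (- g y)) \<in> lat N \<sigma>0" by (rule Y.L0.lat_solid[OF _ g]) auto
  then obtain f2 where f2: "f2 \<in> lat M \<rho>0" "AE y in N. T f2 y = max 0 (- g y)"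
    by (rule T_surj_lat0_nonneg) auto
  have "AE y in N. T (\<lambda>x. f1 x - f2 x) y = g y"
    using T_diff[OF X.lat0_ambient[OF f1(1)] X.lat0_ambient[OF f2(1)]] f1(2) f2(2)
    by eventually_elim (simp add: max_def)
  then show ?thesis using X.L0.lat_diff[OF f1(1) f2(1)] that by blast
qed

lemma norm0_bound:
  obtains K where "\<And>f. f \<in> X.ambient \<Longrightarrow> T f \<in> lat N \<sigma>0 \<Longrightarrow> \<rho>0 f \<le> ennreal K * \<sigma>0 (T f)"
proof -
  obtain K where K: "\<And>f g. f \<in> X.ambient \<Longrightarrow> g \<in> borel_measurable N \<Longrightarrow> AE y in N. 0 \<le> T f y \<Longrightarrow>
      AE y in N. T f y \<le> g y \<Longrightarrow> \<rho>0 f \<le> ennreal K * \<sigma>0 g"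
    using norm0_le_of_T_le by blast
  show ?thesis
  proof (rule that)
    fix f assume f: "f \<in> X.ambient" and Tf: "T f \<in> lat N \<sigma>0"
    note Tf_measurable = T_measurable[OF f]
    obtain h where h: "h \<in> lat M \<rho>0" "AE y in N. T h y = \<bar>T f y\<bar>"
      using T_surj_lat0[OF Y.L0.lat_abs[OF Tf]] by blast
    note h_ambient = X.lat0_ambient[OF h(1)]
    have "AE x in M. f x \<le> h x"
      by (rule T_reflects_le[OF f h_ambient]) (use h(2) in eventually_elim, simp)
    moreover have "AE x in M. -1 * f x \<le> h x"
      by (rule T_reflects_le[OF X.ambient_scale[OF f] h_ambient])
        (use h(2) T_scale[OF f, of "-1"] in \<open>eventually_elim, simp\<close>)
    ultimately have "AE x in M. \<bar>f x\<bar> \<le> \<bar>h x\<bar>" by eventually_elim simp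
    then have "\<rho>0 f \<le> \<rho>0 h" by (intro X.L0.norm_mono X.ambient_measurable f h_ambient)
    also have "\<dots> \<le> ennreal K * \<sigma>0 (\<lambda>y. \<bar>T f y\<bar>)"
      by (rule K[OF h_ambient])
        (use Tf_measurable in measurable, use h(2) in \<open>auto elim!: eventually_mono\<close>)
    finally show "\<rho>0 f \<le> ennreal K * \<sigma>0 (T f)" by (simp add: Y.L0.norm_abs[OF Tf_measurable])
  qed
qed

lemma calderon_isomorphism_swap: "calderon_isomorphism M \<rho>1 \<rho>0 N \<sigma>1 \<sigma>0 T (1 - s)"
proof (intro calderon_isomorphism.intro calderon_isomorphism_axioms.intro
    positive_operator_swap)
  show "order_iso M N T (calderon M \<rho>1 \<rho>0 (1 - s)) (calderon N \<sigma>1 \<sigma>0 (1 - s))"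
    using iso by (simp only: calderon_commute)
qed (use s fatou_dom regular_dom regular_cod in auto)

lemmas T_surj_lat1 = calderon_isomorphism.T_surj_lat0[OF calderon_isomorphism_swap]

lemma T_surj_ambient:
  assumes g: "g \<in> Y.ambient"
  shows "\<exists>f\<in>X.ambient. AE y in N. T f y = g y"
proof -
  obtain g0 g1 where g01: "g0 \<in> lat N \<sigma>0" "g1 \<in> lat N \<sigma>1" "AE y in N. g y = g0 y + g1 y"
    using g by (rule sum_spaceE)
  obtain f0 where f0: "f0 \<in> lat M \<rho>0" "AE y in N. T f0 y = g0 y" by (rule T_surj_lat0[OF g01(1)])
  obtain f1 where f1: "f1 \<in> lat M \<rho>1" "AE y in N. T f1 y = g1 y" by (rule T_surj_lat1[OF g01(2)])
  note in_ambient = X.lat0_ambient[OF f0(1)] X.lat1_ambient[OF f1(1)]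
  have "AE y in N. T (\<lambda>x. f0 x + f1 x) y = g y"
    using T_add[OF in_ambient] f0(2) f1(2) g01(3) by eventually_elim simp
  then show ?thesis using X.ambient_add[OF in_ambient] by blast
qed

definition T_inverse :: "('b \<Rightarrow> real) \<Rightarrow> ('a \<Rightarrow> real)" where
  "T_inverse g = (SOME f. f \<in> X.ambient \<and> (AE y in N. T f y = g y))"

lemma
  assumes g: "g \<in> Y.ambient"
  shows T_inverse_ambient: "T_inverse g \<in> X.ambient"
    and T_T_inverse: "AE y in N. T (T_inverse g) y = g y"
proof -
  have "\<exists>f. f \<in> X.ambient \<and> (AE y in N. T f y = g y)" using T_surj_ambient[OF g] by blast
  then have "T_inverse g \<in> X.ambient \<and> (AE y in N. T (T_inverse g) y = g y)"
    unfolding T_inverse_def by (rule someI_ex)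
  then show "T_inverse g \<in> X.ambient" "AE y in N. T (T_inverse g) y = g y" by blast+
qed

lemma T_inverse_eq:
  assumes "f \<in> X.ambient" "g \<in> Y.ambient" "AE y in N. T f y = g y"
  shows "AE x in M. T_inverse g x = f x"
  by (rule T_injective[OF T_inverse_ambient[OF assms(2)] assms(1)])
    (use T_T_inverse[OF assms(2)] assms(3) in \<open>eventually_elim, simp\<close>)

lemma T_inverse_bounded0: "\<exists>C. \<forall>g \<in> lat N \<sigma>0. \<rho>0 (T_inverse g) \<le> ennreal C * \<sigma>0 g"
proof -
  obtain K where K: "\<And>f. f \<in> X.ambient \<Longrightarrow> T f \<in> lat N \<sigma>0 \<Longrightarrow> \<rho>0 f \<le> ennreal K * \<sigma>0 (T f)"
    using norm0_bound by blast
  have "\<rho>0 (T_inverse g) \<le> ennreal K * \<sigma>0 g" if g: "g \<in> lat N \<sigma>0" for g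
  proof -
    note preimage_ambient = T_inverse_ambient[OF Y.lat0_ambient[OF g]]
      and image_eq = T_T_inverse[OF Y.lat0_ambient[OF g]]
    have "\<rho>0 (T_inverse g) \<le> ennreal K * \<sigma>0 (T (T_inverse g))"
      by (rule K[OF preimage_ambient Y.L0.lat_AE_cong[OF g T_measurable[OF preimage_ambient] image_eq]])
    also have "\<sigma>0 (T (T_inverse g)) = \<sigma>0 g"
      by (rule Y.L0.norm_cong[OF T_measurable[OF preimage_ambient] Y.L0.lat_measurable[OF g] image_eq])
    finally show ?thesis .
  qed
  then show ?thesis by blast
qed

lemma T_inverse_bounded1: "\<exists>C. \<forall>g \<in> lat N \<sigma>1. \<rho>1 (T_inverse g) \<le> ennreal C * \<sigma>1 g"
proof -
  have "calderon_isomorphism.T_inverse M \<rho>1 \<rho>0 N T = T_inverse"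
    by (simp add: fun_eq_iff T_inverse_def
        calderon_isomorphism.T_inverse_def[OF calderon_isomorphism_swap]
        sum_space_commute[of M \<rho>1 \<rho>0])
  then show ?thesis using calderon_isomorphism.T_inverse_bounded0[OF calderon_isomorphism_swap] by simp
qed

lemma positive_operator_T_inverse: "positive_operator N \<sigma>0 \<sigma>1 M \<rho>0 \<rho>1 T_inverse"
proof unfold_locales
  show "admissible_positive_op N \<sigma>0 \<sigma>1 M \<rho>0 \<rho>1 T_inverse"
    unfolding admissible_positive_op_def
  proof (intro conjI ballI allI impI T_inverse_bounded0 T_inverse_bounded1 T_inverse_ambient)
    fix f g assume f: "f \<in> Y.ambient" and g: "g \<in> Y.ambient" and eq: "AE y in N. f y = g y"
    show "AE x in M. T_inverse f x = T_inverse g x"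
      by (rule T_inverse_eq[OF T_inverse_ambient[OF g] f])
        (use T_T_inverse[OF g] eq in \<open>eventually_elim, simp\<close>)
  next
    fix f g a b assume f: "f \<in> Y.ambient" and g: "g \<in> Y.ambient"
    note inverse_f = T_inverse_ambient[OF f] and inverse_g = T_inverse_ambient[OF g]
    show "AE x in M. T_inverse (\<lambda>y. a * f y + b * g y) x = a * T_inverse f x + b * T_inverse g x"
      by (rule T_inverse_eq[OF X.ambient_lincomb[OF inverse_f inverse_g] Y.ambient_lincomb[OF f g]])
        (use T_T_inverse[OF f] T_T_inverse[OF g] T_lincomb[OF inverse_f inverse_g, of a b]
          in \<open>eventually_elim, simp\<close>)
  next
    fix f assume f: "f \<in> Y.ambient" and nonneg: "AE y in N. 0 \<le> f y"
    show "AE x in M. 0 \<le> T_inverse f x"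
      by (rule T_reflects_nonneg[OF T_inverse_ambient[OF f]])
        (use T_T_inverse[OF f] nonneg in \<open>eventually_elim, simp\<close>)
  qed
qed

lemma order_iso_of_invariant:
  assumes "F \<subseteq> X.ambient" "G \<subseteq> Y.ambient" "\<And>f. f \<in> F \<Longrightarrow> T f \<in> G" "\<And>g. g \<in> G \<Longrightarrow> T_inverse g \<in> F"
  shows "order_iso M N T F G"
  unfolding order_iso_def
proof (intro conjI ballI allI impI)
  show "\<exists>f\<in>F. AE y in N. T f y = g y" if "g \<in> G" for g
    using that assms T_T_inverse[of g] by (intro bexI[of _ "T_inverse g"]) auto
qed (use assms T_lincomb T_injective T_nonneg T_reflects_nonneg in \<open>auto simp: subset_eq\<close>)

end

theorem theorem5p2:
  fixes M :: "'a measure" and N :: "'b measure"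
    and \<rho>0 \<rho>1 :: "('a \<Rightarrow> real) \<Rightarrow> ennreal"
    and \<sigma>0 \<sigma>1 :: "('b \<Rightarrow> real) \<Rightarrow> ennreal"
    and T :: "('a \<Rightarrow> real) \<Rightarrow> ('b \<Rightarrow> real)"
    and \<theta>s :: real
  assumes "banach_lattice M \<rho>0" "regular M \<rho>0" "fatou M \<rho>0"
    and "banach_lattice M \<rho>1" "regular M \<rho>1" "fatou M \<rho>1"
    and "banach_lattice N \<sigma>0" "regular N \<sigma>0" "fatou N \<sigma>0"
    and "banach_lattice N \<sigma>1" "regular N \<sigma>1" "fatou N \<sigma>1"
    and "admissible_positive_op M \<rho>0 \<rho>1 N \<sigma>0 \<sigma>1 T"
    and "0 < \<theta>s" "\<theta>s < 1"
    and "order_iso M N T (calderon M \<rho>0 \<rho>1 \<theta>s) (calderon N \<sigma>0 \<sigma>1 \<theta>s)"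
  shows "\<forall>\<theta>. 0 < \<theta> \<and> \<theta> < 1 \<longrightarrow>
           order_iso M N T (calderon M \<rho>0 \<rho>1 \<theta>) (calderon N \<sigma>0 \<sigma>1 \<theta>) \<and>
           (\<forall>p::ennreal. 1 \<le> p \<longrightarrow>
              order_iso M N T (real_interp M \<rho>0 \<rho>1 \<theta> p) (real_interp N \<sigma>0 \<sigma>1 \<theta> p))"
proof -
  interpret calderon_isomorphism M \<rho>0 \<rho>1 N \<sigma>0 \<sigma>1 T \<theta>s
    by unfold_locales (use assms in auto)
  interpret inv: positive_operator N \<sigma>0 \<sigma>1 M \<rho>0 \<rho>1 T_inverse
    by (rule positive_operator_T_inverse)
  show ?thesis
  proof (intro allI impI conjI)
    fix \<theta> :: real assume \<theta>: "0 < \<theta> \<and> \<theta> < 1"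
    show "order_iso M N T (calderon M \<rho>0 \<rho>1 \<theta>) (calderon N \<sigma>0 \<sigma>1 \<theta>)"
      using \<theta> by (intro order_iso_of_invariant X.calderon_subset_ambient Y.calderon_subset_ambient
          T_calderon inv.T_calderon) auto
    show "order_iso M N T (real_interp M \<rho>0 \<rho>1 \<theta> p) (real_interp N \<sigma>0 \<sigma>1 \<theta> p)"
      if "1 \<le> p" for p :: ennreal
      using less_le_trans[OF zero_less_one that]
      by (intro order_iso_of_invariant X.real_interp_subset_ambient Y.real_interp_subset_ambient
          T_real_interp inv.T_real_interp)
  qed
qed

end
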